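(* Let $v_0\in X^1_{\rm per}$ and let $v\in C(\mathbb{R},X^1_{\rm per})$ be the global solution of the Cauchy problem $$v_t+\tfrac16\,\partial_z\big[(z^2-\pi^2)v\big]=\partial_z^{-1}v,\quad t>0,\qquad v|_{t=0}=v_0.$$ Then $$\|v(t)\|_{L^2_{\rm per}}\ \le\ \|v_0\|_{L^2_{\rm per}}\,e^{\pi t/6},\qquad t>0.$$
   Context: $L^2_{\rm per}$ and $H^1_{\rm per}$ are the spaces of $2\pi$-periodic $L^2$ and $H^1$ functions on $(-\pi,\pi)$, and $\dot L^2_{\rm per}$ is the subspace of zero-mean functions in $L^2_{\rm per}$. The function $\pi^2-z^2$ is defined on $[-\pi,\pi]$ and continued $2\pi$-periodically. $X^1_{\rm per}:=\{v\in\dot L^2_{\rm per}:\ \tfrac16(\pi^2-z^2)v\in H^1_{\rm per}\}$, with norm $\|v\|_{X^1_{\rm per}}=\|v\|_{L^2_{\rm per}}+\|\partial_z[\tfrac16(\pi^2-z^2)v]\|_{L^2_{\rm per}}$. The operator $\partial_z^{-1}$ maps a function in $\dot L^2_{\rm per}$ to its unique zero-mean $2\pi$-periodic antiderivative. A solution $v\in C(\mathbb{R},X^1_{\rm per})$ satisfies the equation in $\dot L^2_{\rm per}$; for every $v_0\in X^1_{\rm per}$ such a global solution exists and is unique. *)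

theory Defs
  imports "HOL-Analysis.Analysis"
begin

section \<open>The space of square integrable periodic functions\<close>

text \<open>Every Lebesgue measurable periodic function agrees almost everywhere with a Borel
  measurable periodic one, so restricting to Borel representatives loses no classes.\<close>

definition sq_integrable_per :: "(real \<Rightarrow> real) set" where
  "sq_integrable_per = {f. f \<in> borel_measurable borel \<and> (\<forall>x. f (x + 2 * pi) = f x) \<and>
     set_integrable lborel {-pi..pi} (\<lambda>x. (f x)\<^sup>2)}"

definition L2per_rel :: "(real \<Rightarrow> real) \<Rightarrow> (real \<Rightarrow> real) \<Rightarrow> bool" where
  "L2per_rel f g \<longleftrightarrow> f \<in> sq_integrable_per \<and> g \<in> sq_integrable_per \<and>
     (AE x in lborel. x \<in> {-pi..pi} \<longrightarrow> f x = g x)"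

lemma sq_integrable_per_zero: "(\<lambda>x. 0) \<in> sq_integrable_per"
  by (simp add: sq_integrable_per_def set_integrable_def)

lemma sq_integrable_per_scale:
  assumes "f \<in> sq_integrable_per"
  shows "(\<lambda>x. c * f x) \<in> sq_integrable_per"
  using assms by (auto simp: sq_integrable_per_def power_mult_distrib)

lemma sq_integrable_per_mult_bounded:
  assumes f: "f \<in> sq_integrable_per" and w: "w \<in> borel_measurable borel"
    and per: "\<And>x. w (x + 2 * pi) = w x" and bd: "\<And>x. \<bar>w x\<bar> \<le> B"
  shows "(\<lambda>x. w x * f x) \<in> sq_integrable_per"
proof -
  have [measurable]: "f \<in> borel_measurable borel" "w \<in> borel_measurable borel"
    using f w by (auto simp: sq_integrable_per_def)
  have i: "set_integrable lborel {-pi..pi} (\<lambda>x. B\<^sup>2 * (f x)\<^sup>2)"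
    using f by (auto simp: sq_integrable_per_def)
  have "(w x)\<^sup>2 \<le> B\<^sup>2" for x
    using power_mono[OF bd[of x] abs_ge_zero, of 2] by simp
  hence le: "(w x * f x)\<^sup>2 \<le> B\<^sup>2 * (f x)\<^sup>2" for x
    by (simp add: power_mult_distrib mult_right_mono)
  have "set_integrable lborel {-pi..pi} (\<lambda>x. (w x * f x)\<^sup>2)"
    using i unfolding set_integrable_def
    by (rule Bochner_Integration.integrable_bound)
       (auto intro!: AE_I2 simp: indicator_def le)
  thus ?thesis
    using f per by (auto simp: sq_integrable_per_def)
qed

lemma sq_integrable_per_integrable_mult:
  assumes f: "f \<in> sq_integrable_per" and g: "g \<in> sq_integrable_per"
  shows "set_integrable lborel {-pi..pi} (\<lambda>x. f x * g x)"
proof -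
  have [measurable]: "f \<in> borel_measurable borel" "g \<in> borel_measurable borel"
    using f g by (auto simp: sq_integrable_per_def)
  have i: "set_integrable lborel {-pi..pi} (\<lambda>x. (f x)\<^sup>2 + (g x)\<^sup>2)"
    using f g by (auto simp: sq_integrable_per_def)
  have le: "\<bar>f x * g x\<bar> \<le> (f x)\<^sup>2 + (g x)\<^sup>2" for x
  proof -
    have "2 * (\<bar>f x\<bar> * \<bar>g x\<bar>) \<le> (f x)\<^sup>2 + (g x)\<^sup>2"
      using sum_squares_bound[of "\<bar>f x\<bar>" "\<bar>g x\<bar>"] by simp
    moreover have "0 \<le> \<bar>f x\<bar> * \<bar>g x\<bar>" by simp
    ultimately show ?thesis by (simp only: abs_mult)
  qed
  show ?thesis
    using i unfolding set_integrable_def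
    by (rule Bochner_Integration.integrable_bound)
       (auto intro!: AE_I2 simp: indicator_def le)
qed

lemma sq_integrable_per_add:
  assumes f: "f \<in> sq_integrable_per" and g: "g \<in> sq_integrable_per"
  shows "(\<lambda>x. f x + g x) \<in> sq_integrable_per"
proof -
  have "set_integrable lborel {-pi..pi} (\<lambda>x. (f x)\<^sup>2 + 2 * (f x * g x) + (g x)\<^sup>2)"
    using f g sq_integrable_per_integrable_mult[OF f g]
    by (intro set_integral_add) (auto simp: sq_integrable_per_def)
  moreover have "(\<lambda>x. (f x)\<^sup>2 + 2 * (f x * g x) + (g x)\<^sup>2) = (\<lambda>x. (f x + g x)\<^sup>2)"
    by (auto simp: power2_sum)
  ultimately show ?thesis
    using f g by (auto simp: sq_integrable_per_def)
qed

lemma sq_integrable_per_uminus: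
  "f \<in> sq_integrable_per \<Longrightarrow> (\<lambda>x. - f x) \<in> sq_integrable_per"
  using sq_integrable_per_scale[of f "-1"] by simp

lemma sq_integrable_per_diff:
  "f \<in> sq_integrable_per \<Longrightarrow> g \<in> sq_integrable_per \<Longrightarrow> (\<lambda>x. f x - g x) \<in> sq_integrable_per"
  using sq_integrable_per_add[of f "\<lambda>x. - g x"] sq_integrable_per_uminus[of g] by simp

lemma L2per_rel_integral_cong:
  assumes "L2per_rel f f'" "L2per_rel g g'"
  shows "(LINT x:{-pi..pi}|lborel. f x * g x) = (LINT x:{-pi..pi}|lborel. f' x * g' x)"
proof -
  have [measurable]: "f \<in> borel_measurable borel" "g \<in> borel_measurable borel"
    "f' \<in> borel_measurable borel" "g' \<in> borel_measurable borel"
    using assms by (auto simp: L2per_rel_def sq_integrable_per_def)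
  have "AE x in lborel. x \<in> {-pi..pi} \<longrightarrow> f x = f' x"
       "AE x in lborel. x \<in> {-pi..pi} \<longrightarrow> g x = g' x"
    using assms by (auto simp: L2per_rel_def)
  hence "AE x in lborel. x \<in> {-pi..pi} \<longrightarrow> f x * g x = f' x * g' x"
    by eventually_elim auto
  thus ?thesis
    by (intro set_lebesgue_integral_cong_AE) auto
qed

lemma L2per_rel_integral_cong_left:
  assumes "L2per_rel f f'"
  shows "(LINT x:{-pi..pi}|lborel. f x) = (LINT x:{-pi..pi}|lborel. f' x)"
proof -
  have [measurable]: "f \<in> borel_measurable borel" "f' \<in> borel_measurable borel"
    using assms by (auto simp: L2per_rel_def sq_integrable_per_def)
  show ?thesis
    using assms by (intro set_lebesgue_integral_cong_AE) (auto simp: L2per_rel_def)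
qed

quotient_type L2per = "real \<Rightarrow> real" / partial: L2per_rel
proof (rule part_equivpI)
  show "\<exists>f. L2per_rel f f"
    using sq_integrable_per_zero by (auto simp: L2per_rel_def)
  show "symp L2per_rel"
    by (rule sympI) (auto simp: L2per_rel_def elim: AE_mp)
  show "transp L2per_rel"
  proof (rule transpI)
    fix f g h
    assume "L2per_rel f g" "L2per_rel g h"
    hence m: "f \<in> sq_integrable_per" "h \<in> sq_integrable_per"
      and a: "AE x in lborel. x \<in> {-pi..pi} \<longrightarrow> f x = g x"
             "AE x in lborel. x \<in> {-pi..pi} \<longrightarrow> g x = h x"
      by (auto simp: L2per_rel_def)
    from a have "AE x in lborel. x \<in> {-pi..pi} \<longrightarrow> f x = h x"
      by eventually_elim auto
    with m show "L2per_rel f h" by (auto simp: L2per_rel_def)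
  qed
qed

instantiation L2per :: real_inner
begin

lift_definition zero_L2per :: L2per is "\<lambda>x. 0"
  by (simp add: L2per_rel_def sq_integrable_per_zero)

lift_definition plus_L2per :: "L2per \<Rightarrow> L2per \<Rightarrow> L2per" is "\<lambda>f g x. f x + g x"
  unfolding L2per_rel_def by (auto intro: sq_integrable_per_add elim!: AE_mp)

lift_definition uminus_L2per :: "L2per \<Rightarrow> L2per" is "\<lambda>f x. - f x"
  unfolding L2per_rel_def by (auto intro: sq_integrable_per_uminus elim!: AE_mp)

lift_definition minus_L2per :: "L2per \<Rightarrow> L2per \<Rightarrow> L2per" is "\<lambda>f g x. f x - g x"
  unfolding L2per_rel_def by (auto intro: sq_integrable_per_diff elim!: AE_mp)

lift_definition scaleR_L2per :: "real \<Rightarrow> L2per \<Rightarrow> L2per" is "\<lambda>c f x. c * f x"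
  unfolding L2per_rel_def by (auto intro: sq_integrable_per_scale elim!: AE_mp)

lift_definition inner_L2per :: "L2per \<Rightarrow> L2per \<Rightarrow> real" is
  "\<lambda>f g. LINT x:{-pi..pi}|lborel. f x * g x"
  by (rule L2per_rel_integral_cong)

definition norm_L2per :: "L2per \<Rightarrow> real" where
  "norm_L2per f = sqrt (inner f f)"

definition dist_L2per :: "L2per \<Rightarrow> L2per \<Rightarrow> real" where
  "dist_L2per f g = norm (f - g)"

definition sgn_L2per :: "L2per \<Rightarrow> L2per" where
  "sgn_L2per f = scaleR (inverse (norm f)) f"

definition uniformity_L2per :: "(L2per \<times> L2per) filter" where
  "uniformity_L2per = (INF e\<in>{0<..}. principal {(x, y). dist x y < e})"

definition open_L2per :: "L2per set \<Rightarrow> bool" where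
  "open_L2per U \<longleftrightarrow> (\<forall>x\<in>U. eventually (\<lambda>(x', y). x' = x \<longrightarrow> y \<in> U) uniformity)"

instance
proof
  fix f g h :: L2per and a b :: real
  show "f + g + h = f + (g + h)"
    by transfer (auto simp: L2per_rel_def add.assoc intro!: sq_integrable_per_add)
  show "f + g = g + f"
    by transfer (auto simp: L2per_rel_def add.commute intro!: sq_integrable_per_add)
  show "0 + f = f"
    by transfer (auto simp: L2per_rel_def)
  show "- f + f = 0"
    by transfer (auto simp: L2per_rel_def sq_integrable_per_zero)
  show "f - g = f + - g"
    by transfer (auto simp: L2per_rel_def intro!: sq_integrable_per_diff)
  show "a *\<^sub>R (f + g) = a *\<^sub>R f + a *\<^sub>R g"
    by transfer (auto simp: L2per_rel_def distrib_left
        intro!: sq_integrable_per_add sq_integrable_per_scale)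
  show "(a + b) *\<^sub>R f = a *\<^sub>R f + b *\<^sub>R f"
    by transfer (auto simp: L2per_rel_def distrib_right
        intro!: sq_integrable_per_add sq_integrable_per_scale)
  show "a *\<^sub>R b *\<^sub>R f = (a * b) *\<^sub>R f"
    by transfer (auto simp: L2per_rel_def mult.assoc intro!: sq_integrable_per_scale)
  show "1 *\<^sub>R f = f"
    by transfer (auto simp: L2per_rel_def)
  show "dist f g = norm (f - g)" by (rule dist_L2per_def)
  show "sgn f = scaleR (inverse (norm f)) f" by (rule sgn_L2per_def)
  show "(uniformity :: (L2per \<times> L2per) filter) = (INF e\<in>{0<..}. principal {(x, y). dist x y < e})"
    by (rule uniformity_L2per_def)
  show "open U \<longleftrightarrow> (\<forall>x\<in>U. eventually (\<lambda>(x', y). x' = x \<longrightarrow> y \<in> U) uniformity)"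
    for U :: "L2per set"
    by (rule open_L2per_def)
  show "inner f g = inner g f"
    by transfer (simp add: mult.commute)
  show "inner (f + g) h = inner f h + inner g h"
  proof (transfer, goal_cases)
    case (1 f g h)
    thus ?case
      using set_integral_add(2)[OF sq_integrable_per_integrable_mult[of f h]
          sq_integrable_per_integrable_mult[of g h]]
      by (simp add: L2per_rel_def distrib_right)
  qed
  show "inner (a *\<^sub>R f) g = a * inner f g"
    by transfer (simp add: mult.assoc)
  show "0 \<le> inner f f"
    by transfer (auto simp: set_lebesgue_integral_def intro!: integral_nonneg_AE)
  show "inner f f = 0 \<longleftrightarrow> f = 0"
  proof (transfer, goal_cases)
    case (1 f)
    hence f: "f \<in> sq_integrable_per" by (simp add: L2per_rel_def)
    have i: "integrable lborel (\<lambda>x. indicator {-pi..pi} x *\<^sub>R (f x * f x))"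
      using sq_integrable_per_integrable_mult[OF f f] by (simp add: set_integrable_def)
    have "(LINT x:{-pi..pi}|lborel. f x * f x) = 0 \<longleftrightarrow>
        (AE x in lborel. indicator {-pi..pi} x *\<^sub>R (f x * f x) = 0)"
      unfolding set_lebesgue_integral_def
      by (intro integral_nonneg_eq_0_iff_AE i) auto
    also have "\<dots> \<longleftrightarrow> (AE x in lborel. x \<in> {-pi..pi} \<longrightarrow> f x = 0)"
      by (intro AE_cong) (auto simp: indicator_def)
    finally show ?case
      using f sq_integrable_per_zero by (simp add: L2per_rel_def)
  qed
  show "norm f = sqrt (inner f f)" by (rule norm_L2per_def)
qed

end

lift_definition L2per_integral :: "L2per \<Rightarrow> real" is "\<lambda>f. LINT x:{-pi..pi}|lborel. f x"
  by (rule L2per_rel_integral_cong_left)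

definition L2per_zero_mean :: "L2per set" where
  "L2per_zero_mean = {f. L2per_integral f = 0}"


section \<open>Weak derivatives and the Sobolev space of order one\<close>

definition test_fun_per :: "(real \<Rightarrow> real) \<Rightarrow> bool" where
  "test_fun_per \<phi> \<longleftrightarrow> (\<forall>x. \<phi> (x + 2 * pi) = \<phi> x) \<and>
     (\<forall>n x. ((deriv ^^ n) \<phi>) field_differentiable (at x))"

lemma test_fun_per_measurable:
  assumes "test_fun_per \<phi>"
  shows "\<phi> \<in> borel_measurable borel" and "deriv \<phi> \<in> borel_measurable borel"
proof -
  have d: "((deriv ^^ n) \<phi>) \<in> borel_measurable borel" for n
    using assms unfolding test_fun_per_def
    by (intro borel_measurable_continuous_onI continuous_at_imp_continuous_on ballI
        field_differentiable_imp_continuous_at) auto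
  show "\<phi> \<in> borel_measurable borel" "deriv \<phi> \<in> borel_measurable borel"
    using d[of 0] d[of 1] by simp_all
qed

lemma L2per_rel_integral_mult_cong:
  assumes "L2per_rel f f'" and [measurable]: "\<psi> \<in> borel_measurable borel"
  shows "(LINT x:{-pi..pi}|lborel. f x * \<psi> x) = (LINT x:{-pi..pi}|lborel. f' x * \<psi> x)"
proof -
  have [measurable]: "f \<in> borel_measurable borel" "f' \<in> borel_measurable borel"
    and ae: "AE x in lborel. x \<in> {-pi..pi} \<longrightarrow> f x = f' x"
    using assms by (auto simp: L2per_rel_def sq_integrable_per_def)
  from ae have "AE x in lborel. x \<in> {-pi..pi} \<longrightarrow> f x * \<psi> x = f' x * \<psi> x"
    by eventually_elim auto
  thus ?thesis
    by (intro set_lebesgue_integral_cong_AE) auto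
qed

lift_definition has_weak_deriv :: "L2per \<Rightarrow> L2per \<Rightarrow> bool" is
  "\<lambda>f g. \<forall>\<phi>. test_fun_per \<phi> \<longrightarrow>
     (LINT x:{-pi..pi}|lborel. f x * deriv \<phi> x) = - (LINT x:{-pi..pi}|lborel. g x * \<phi> x)"
  by (simp add: test_fun_per_measurable L2per_rel_integral_mult_cong cong: imp_cong)

definition H1per :: "L2per set" where
  "H1per = {f. \<exists>g. has_weak_deriv f g}"

text \<open>Weak derivatives are unique as elements of \<^typ>\<open>L2per\<close>; outside \<^const>\<open>H1per\<close> the
  value is unspecified.\<close>

definition dz :: "L2per \<Rightarrow> L2per" where
  "dz f = (THE g. has_weak_deriv f g)"

text \<open>Meaningful on \<^const>\<open>L2per_zero_mean\<close> only, where the antiderivative exists and is unique.\<close>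

definition dz_inv :: "L2per \<Rightarrow> L2per" where
  "dz_inv f = (THE g. g \<in> L2per_zero_mean \<and> has_weak_deriv g f)"


section \<open>The weighted space\<close>

text \<open>The periodic continuation of a function given on the period $[-\pi, \pi)$.\<close>

definition per_ext :: "(real \<Rightarrow> real) \<Rightarrow> real \<Rightarrow> real" where
  "per_ext g x = g (x - 2 * pi * of_int \<lfloor>(x + pi) / (2 * pi)\<rfloor>)"

definition weight :: "real \<Rightarrow> real" where
  "weight = per_ext (\<lambda>z. pi\<^sup>2 - z\<^sup>2)"

lemma weight_measurable: "weight \<in> borel_measurable borel"
  unfolding weight_def per_ext_def by measurable

lemma weight_periodic: "weight (x + 2 * pi) = weight x"
proof -
  have "(x + 2 * pi + pi) / (2 * pi) = (x + pi) / (2 * pi) + 1"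
    by (simp add: field_simps)
  hence "\<lfloor>(x + 2 * pi + pi) / (2 * pi)\<rfloor> = \<lfloor>(x + pi) / (2 * pi)\<rfloor> + 1"
    by simp
  thus ?thesis by (simp add: weight_def per_ext_def algebra_simps)
qed

lemma weight_bounded: "\<bar>weight x\<bar> \<le> pi\<^sup>2"
proof -
  define n where "n = \<lfloor>(x + pi) / (2 * pi)\<rfloor>"
  define y where "y = x - 2 * pi * of_int n"
  have "of_int n \<le> (x + pi) / (2 * pi)" "(x + pi) / (2 * pi) < of_int n + 1"
    unfolding n_def by linarith+
  hence "of_int n * (2 * pi) \<le> x + pi" "x + pi < (of_int n + 1) * (2 * pi)"
    by (simp_all add: pos_le_divide_eq pos_divide_less_eq)
  hence "\<bar>y\<bar> \<le> pi" by (auto simp: y_def algebra_simps abs_le_iff)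
  hence "y\<^sup>2 \<le> pi\<^sup>2" using power_mono[of "\<bar>y\<bar>" pi 2] by simp
  thus ?thesis by (simp add: weight_def per_ext_def y_def n_def)
qed

lift_definition weight_mult :: "L2per \<Rightarrow> L2per" is "\<lambda>f x. weight x * f x"
  unfolding L2per_rel_def
  by (auto intro: sq_integrable_per_mult_bounded weight_measurable weight_periodic weight_bounded
      elim!: AE_mp)

definition X1per :: "L2per set" where
  "X1per = {v \<in> L2per_zero_mean. (1/6) *\<^sub>R weight_mult v \<in> H1per}"

definition X1norm :: "L2per \<Rightarrow> real" where
  "X1norm v = norm v + norm (dz ((1/6) *\<^sub>R weight_mult v))"

definition continuous_X1 :: "(real \<Rightarrow> L2per) \<Rightarrow> bool" where
  "continuous_X1 v \<longleftrightarrow> (\<forall>t. v t \<in> X1per) \<and>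
     (\<forall>t. ((\<lambda>s. X1norm (v s - v t)) \<longlongrightarrow> 0) (at t))"


section \<open>The Cauchy problem\<close>

text \<open>The time derivative is the strong derivative in \<^typ>\<open>L2per\<close>, and \<open>- weight_mult (v t)\<close>
  stands for $(z^2 - \pi^2) v(t)$.\<close>

definition global_solution :: "L2per \<Rightarrow> (real \<Rightarrow> L2per) \<Rightarrow> bool" where
  "global_solution v0 v \<longleftrightarrow> continuous_X1 v \<and> v 0 = v0 \<and>
     (\<forall>t>0. \<exists>vt. (v has_vector_derivative vt) (at t) \<and>
        vt + (1/6) *\<^sub>R dz (- weight_mult (v t)) = dz_inv (v t))"

end

theory Submission imports Defs begin

text \<open>Pairing the equation with $v$ gives
  $\frac{d}{dt}\|v\|^2 = 2\langle v, \partial_z^{-1} v\rangle + \frac13 \langle v, \partial_z (w v)\rangle$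
  with $w = \pi^2 - z^2$. The first term vanishes, and the second one equals $-\frac13 \int z v^2
  \le \frac{\pi}{3} \|v\|^2$, so $e^{-\pi t/3} \|v(t)\|^2$ is nonincreasing. To justify the
  integrations by parts, a function with a weak derivative is identified with an indefinite integral
  of that derivative, using that the trigonometric polynomials separate integrable functions.\<close>

section \<open>Absolutely continuous functions on an interval\<close>

text \<open>Membership in \<open>X1per\<close> makes w v weakly differentiable, but not v itself,
  which may blow up at the ends of the period where w vanishes. So <v, (w v)'> cannot be integrated
  by parts as it stands; the quotient v = (w v) / w is replaced by (w v) / (w + e), and e tends to 0
  only after the integration. The other pairing has no such difficulty: v is the weak derivative of
  its antiderivative F, and 2 <F, v> is the integral of the derivative of F^2 over a period. Weak
  derivatives are tested with periodic functions only, and the derivative of a periodic function has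
  mean zero. Testing therefore determines a function only up to an additive constant; the constants
  c and m that recur below are means that have to be removed or matched. Since \<open>dz\<close> and
  \<open>dz_inv\<close> are definite descriptions, nothing can be said about their values before
  uniqueness, and for \<open>dz_inv\<close> also existence, is settled.\<close>

lemma integral_mult_indefinite:
  fixes u w :: "real \<Rightarrow> real"
  assumes u: "integrable lborel u" and w: "integrable lborel w"
  shows "integrable lborel (\<lambda>x. u x * (LINT y|lborel. indicator {..x} y * w y))" (is ?A)
    and "(LINT x|lborel. u x * (LINT y|lborel. indicator {..x} y * w y)) +
      (LINT x|lborel. w x * (LINT y|lborel. indicator {..x} y * u y)) =
      (LINT x|lborel. u x) * (LINT x|lborel. w x)" (is ?B)
proof -
  note [measurable] = borel_measurable_integrable[OF u, simplified] borel_measurable_integrable[OF w, simplified]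
  have h: "integrable (lborel \<Otimes>\<^sub>M lborel) (\<lambda>(x, y). u x * w y)"
  proof (rule lborel_pair.Fubini_integrable)
    show "integrable lborel (\<lambda>x. LINT y|lborel. norm (case (x, y) of (x, y) \<Rightarrow> u x * w y))"
      using u by (simp add: abs_mult)
  qed (use w in \<open>auto simp: case_prod_unfold\<close>)
  have sub: "integrable (lborel \<Otimes>\<^sub>M lborel) (\<lambda>(x, y). indicator S (x, y) * (u x * w y))"
    if [measurable]: "S \<in> sets (borel \<Otimes>\<^sub>M borel)" for S
    by (rule Bochner_Integration.integrable_bound[OF h])
      (auto simp: indicator_def case_prod_unfold)
  \<comment> \<open>Fubini for u(x) w(y): integrating over y <= x gives the first double integral,
    over x < y the second. The diagonal is a null set, which is why the strict half-plane may be
    traded for the closed ray in \<open>gw\<close>.\<close>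
  let ?L = "{z :: real \<times> real. snd z \<le> fst z}" and ?G = "{z :: real \<times> real. fst z < snd z}"
  have L: "?L \<in> sets (borel \<Otimes>\<^sub>M borel)" and G: "?G \<in> sets (borel \<Otimes>\<^sub>M borel)"
    unfolding borel_prod
    by (intro borel_closed borel_open closed_Collect_le open_Collect_less continuous_intros)+
  have lu: "(LINT y|lborel. indicator ?L (x, y) * (u x * w y)) =
      u x * (LINT y|lborel. indicator {..x} y * w y)" for x
    by (subst integral_mult_right_zero[symmetric], intro Bochner_Integration.integral_cong)
      (auto simp: indicator_def)
  have gw: "(LINT x|lborel. indicator ?G (x, y) * (u x * w y)) =
      w y * (LINT x|lborel. indicator {..y} x * u x)" for y
    unfolding integral_mult_right_zero[symmetric]
  proof (rule integral_cong_AE)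
    show "AE x in lborel. indicator ?G (x, y) * (u x * w y) = w y * (indicator {..y} x * u x)"
      using AE_lborel_singleton[of y] by eventually_elim (auto simp: indicator_def)
  qed (use G in measurable)
  show ?A
    using lborel_pair.integrable_fst'[OF sub[OF L]] by (simp add: lu)
  have "(LINT x|lborel. u x) * (LINT x|lborel. w x) =
      integral\<^sup>L (lborel \<Otimes>\<^sub>M lborel) (\<lambda>(x, y). u x * w y)"
    using lborel_pair.integral_fst'[OF h] by simp
  also have "\<dots> = integral\<^sup>L (lborel \<Otimes>\<^sub>M lborel)
      (\<lambda>z. (case z of (x, y) \<Rightarrow> indicator ?L (x, y) * (u x * w y)) +
        (case z of (x, y) \<Rightarrow> indicator ?G (x, y) * (u x * w y)))"
    by (intro Bochner_Integration.integral_cong) (auto simp: indicator_def)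
  also have "\<dots> = integral\<^sup>L (lborel \<Otimes>\<^sub>M lborel) (\<lambda>(x, y). indicator ?L (x, y) * (u x * w y)) +
      integral\<^sup>L (lborel \<Otimes>\<^sub>M lborel) (\<lambda>(x, y). indicator ?G (x, y) * (u x * w y))"
    by (intro Bochner_Integration.integral_add sub L G)
  also have "\<dots> = (LINT x|lborel. LINT y|lborel. indicator ?L (x, y) * (u x * w y)) +
      (LINT y|lborel. LINT x|lborel. indicator ?G (x, y) * (u x * w y))"
    using lborel_pair.integral_fst'[OF sub[OF L]] lborel_pair.integral_snd[OF sub[OF G]] by simp
  finally show ?B
    by (simp only: lu gw)
qed

text \<open>\<open>U\<close> is absolutely continuous on $[a, b]$ with derivative \<open>u\<close> almost everywhere.\<close>

definition ac_on :: "real \<Rightarrow> real \<Rightarrow> (real \<Rightarrow> real) \<Rightarrow> (real \<Rightarrow> real) \<Rightarrow> bool" where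
  "ac_on a b U u \<longleftrightarrow> set_integrable lborel {a..b} u \<and>
     (\<forall>x\<in>{a..b}. (LINT y:{a..x}|lborel. u y) = U x - U a)"

lemma ac_on_continuous:
  assumes "ac_on a b U u"
  shows "continuous_on {a..b} U"
proof -
  have i: "set_integrable lborel {a..b} u" using assms by (simp add: ac_on_def)
  have "continuous_on {a..b} (\<lambda>x. U a + integral {a..x} u)"
    by (intro continuous_intros indefinite_integral_continuous_1 set_borel_integral_eq_integral i)
  moreover have "U a + integral {a..x} u = U x" if "x \<in> {a..b}" for x
  proof -
    have "set_integrable lborel {a..x} u"
      by (rule set_integrable_subset[OF i]) (use that in auto)
    thus ?thesis
      using assms that set_borel_integral_eq_integral(2)[of "{a..x}" u] by (auto simp: ac_on_def)
  qed
  ultimately show ?thesis by (rule continuous_on_eq)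
qed

lemma set_integrable_mult_continuous:
  fixes f g :: "real \<Rightarrow> real"
  assumes f: "set_integrable lborel {a..b} f" and g: "continuous_on {a..b} g"
  shows "set_integrable lborel {a..b} (\<lambda>x. f x * g x)"
proof -
  have "bounded (g ` {a..b})"
    by (intro compact_imp_bounded compact_continuous_image g compact_Icc)
  then obtain B where B: "\<And>x. x \<in> {a..b} \<Longrightarrow> \<bar>g x\<bar> \<le> B"
    unfolding bounded_iff by (auto simp del: atLeastAtMost_iff)
  have "(\<lambda>x. indicator {a..b} x *\<^sub>R f x) \<in> borel_measurable lborel"
    using f unfolding set_integrable_def by (rule borel_measurable_integrable)
  moreover have "(\<lambda>x. indicator {a..b} x *\<^sub>R g x) \<in> borel_measurable borel"
    by (rule borel_measurable_continuous_on_indicator[OF _ g]) auto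
  ultimately have "(\<lambda>x. (indicator {a..b} x *\<^sub>R f x) * (indicator {a..b} x *\<^sub>R g x))
      \<in> borel_measurable lborel"
    by (intro borel_measurable_times) simp_all
  also have "(\<lambda>x. (indicator {a..b} x *\<^sub>R f x) * (indicator {a..b} x *\<^sub>R g x)) =
      (\<lambda>x. indicator {a..b} x *\<^sub>R (f x * g x))"
    by (auto simp: indicator_def)
  finally have m: "(\<lambda>x. indicator {a..b} x *\<^sub>R (f x * g x)) \<in> borel_measurable lborel" .
  have "set_integrable lborel {a..b} (\<lambda>x. B * f x)"
    using f by simp
  thus ?thesis unfolding set_integrable_def
  proof (rule Bochner_Integration.integrable_bound[OF _ m], intro AE_I2)
    fix x
    have "\<bar>f x * g x\<bar> \<le> \<bar>B * f x\<bar>" if "x \<in> {a..b}"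
      using mult_left_mono[OF order_trans[OF B[OF that] abs_ge_self] abs_ge_zero[of "f x"]]
      by (simp add: abs_mult mult.commute)
    thus "norm (indicator {a..b} x *\<^sub>R (f x * g x)) \<le> norm (indicator {a..b} x *\<^sub>R (B * f x))"
      by (auto simp: indicator_def)
  qed
qed

lemma ac_on_subinterval:
  assumes "ac_on a b U u" "x \<le> b"
  shows "ac_on a x U u"
  using assms by (auto simp: ac_on_def intro: set_integrable_subset)

lemma ac_on_parts:
  assumes U: "ac_on a b U u" and V: "ac_on a b V v" and ab: "a \<le> b"
  shows "(LINT x:{a..b}|lborel. u x * V x + U x * v x) = U b * V b - U a * V a"
proof -
  have iu: "set_integrable lborel {a..b} u" and iv: "set_integrable lborel {a..b} v"
    using U V by (auto simp: ac_on_def)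
  have prim: "indicator {a..b} x *\<^sub>R (f x * F x) = (indicator {a..b} x * f x) * F a +
      (indicator {a..b} x * f x) * (LINT y|lborel. indicator {..x} y * (indicator {a..b} y * g y))"
    if "ac_on a b F g" for F g f and x :: real
  proof (cases "x \<in> {a..b}")
    case True
    have "(LINT y|lborel. indicator {..x} y * (indicator {a..b} y * g y)) = (LINT y:{a..x}|lborel. g y)"
      unfolding set_lebesgue_integral_def
      by (intro Bochner_Integration.integral_cong) (use True in \<open>auto simp: indicator_def\<close>)
    moreover have "F x = F a + (LINT y:{a..x}|lborel. g y)"
      using that True by (simp add: ac_on_def)
    ultimately show ?thesis
      using True by (simp only:) (simp add: algebra_simps)
  qed simp
  let ?u = "\<lambda>x. indicator {a..b} x * u x" and ?v = "\<lambda>x. indicator {a..b} x * v x"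
  have i: "integrable lborel ?u" "integrable lborel ?v"
    using iu iv by (simp_all add: set_integrable_def)
  have eu: "(LINT x|lborel. ?u x) = U b - U a" and ev: "(LINT x|lborel. ?v x) = V b - V a"
    using U V ab by (simp_all add: ac_on_def set_lebesgue_integral_def)
  have "(LINT x:{a..b}|lborel. u x * V x + v x * U x) =
      (LINT x:{a..b}|lborel. u x * V x) + (LINT x:{a..b}|lborel. v x * U x)"
    by (intro set_integral_add set_integrable_mult_continuous iu iv ac_on_continuous[OF U]
        ac_on_continuous[OF V])
  also have "(LINT x:{a..b}|lborel. u x * V x) = (U b - U a) * V a +
      (LINT x|lborel. ?u x * (LINT y|lborel. indicator {..x} y * ?v y))"
    unfolding set_lebesgue_integral_def prim[OF V]
    using i integral_mult_indefinite(1)[of ?u ?v]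
    by (subst Bochner_Integration.integral_add) (auto simp: eu)
  also have "(LINT x:{a..b}|lborel. v x * U x) = (V b - V a) * U a +
      (LINT x|lborel. ?v x * (LINT y|lborel. indicator {..x} y * ?u y))"
    unfolding set_lebesgue_integral_def prim[OF U]
    using i integral_mult_indefinite(1)[of ?v ?u]
    by (subst Bochner_Integration.integral_add) (auto simp: ev)
  also have "(U b - U a) * V a + (LINT x|lborel. ?u x * (LINT y|lborel. indicator {..x} y * ?v y)) +
      ((V b - V a) * U a + (LINT x|lborel. ?v x * (LINT y|lborel. indicator {..x} y * ?u y))) =
      (U b - U a) * V a + (V b - V a) * U a + (U b - U a) * (V b - V a)"
    using integral_mult_indefinite(2)[OF i] by (simp only: eu ev)
  finally show ?thesis by (simp add: algebra_simps)
qed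

text \<open>The identity that \<open>ac_on\<close> demands at a point x is integration by parts on
  {a..x}.\<close>

lemma ac_on_mult:
  assumes U: "ac_on a b U u" and V: "ac_on a b V v"
  shows "ac_on a b (\<lambda>x. U x * V x) (\<lambda>x. u x * V x + U x * v x)"
  unfolding ac_on_def
proof (intro conjI ballI)
  show "set_integrable lborel {a..b} (\<lambda>x. u x * V x + U x * v x)"
    using U V set_integrable_mult_continuous[of a b u V] set_integrable_mult_continuous[of a b v U]
      ac_on_continuous[OF U] ac_on_continuous[OF V]
    by (intro set_integral_add) (auto simp: ac_on_def mult.commute)
qed (use ac_on_parts[OF ac_on_subinterval[OF U] ac_on_subinterval[OF V]] in auto)

lemma ac_on_C1:
  assumes d: "\<And>x. x \<in> {a..b} \<Longrightarrow> (U has_real_derivative u x) (at x within {a..b})"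
    and c: "continuous_on {a..b} u"
  shows "ac_on a b U u"
  unfolding ac_on_def
proof (intro conjI ballI)
  show i: "set_integrable lborel {a..b} u"
    unfolding set_integrable_def by (rule borel_integrable_compact[OF compact_Icc c])
  fix x assume x: "x \<in> {a..b}"
  have "(u has_integral U x - U a) {a..x}"
    using x by (intro fundamental_theorem_of_calculus)
      (auto simp: has_real_derivative_iff_has_vector_derivative[symmetric]
        intro: DERIV_subset[OF d])
  moreover have "set_integrable lborel {a..x} u"
    by (rule set_integrable_subset[OF i]) (use x in auto)
  ultimately show "(LINT y:{a..x}|lborel. u y) = U x - U a"
    by (simp add: set_borel_integral_eq_integral integral_unique)
qed

lemma ac_on_DERIV:
  assumes "\<And>x. (U has_real_derivative u x) (at x)" "continuous_on {a..b} u"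
  shows "ac_on a b U u"
  by (rule ac_on_C1) (use assms in \<open>auto intro: DERIV_subset\<close>)

lemma ac_on_integral:
  "ac_on a b U u \<Longrightarrow> a \<le> b \<Longrightarrow> (LINT x:{a..b}|lborel. u x) = U b - U a"
  by (simp add: ac_on_def)

text \<open>The positive and negative parts of f are densities of finite measures that agree on all
  rays, hence everywhere. So the two parts coincide almost everywhere, and this forces both to be
  0.\<close>

lemma AE_zero_of_indefinite_integral_zero:
  fixes f :: "real \<Rightarrow> real"
  assumes f: "integrable lborel f" and z: "\<And>x. (LINT y:{..x}|lborel. f y) = 0"
    and t: "(LINT y|lborel. f y) = 0"
  shows "AE x in lborel. f x = 0"
proof -
  note [measurable] = borel_measurable_integrable[OF f, simplified]
  let ?p = "\<lambda>x. max 0 (f x)" and ?n = "\<lambda>x. max 0 (- f x)"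
  have i: "integrable lborel (\<lambda>x. indicator A x * ?p x)" "integrable lborel (\<lambda>x. indicator A x * ?n x)"
    if [measurable]: "A \<in> sets borel" for A
    by (rule Bochner_Integration.integrable_bound[OF f]; auto simp: indicator_def)+
  have em: "emeasure (density lborel (\<lambda>x. ennreal (g x))) A = ennreal (LINT x|lborel. indicator A x * g x)"
    if [measurable]: "A \<in> sets borel" "g \<in> borel_measurable borel"
      and g: "\<And>x. 0 \<le> g x" and "integrable lborel (\<lambda>x. indicator A x * g x)" for g A
    using that by (subst nn_integral_eq_integral[symmetric])
      (auto simp: emeasure_density intro!: nn_integral_cong split: split_indicator)
  have "density lborel (\<lambda>x. ennreal (?p x)) = density lborel (\<lambda>x. ennreal (?n x))"
  proof (rule measure_eqI_lessThan)
    fix x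
    show "emeasure (density lborel (\<lambda>x. ennreal (?p x))) {x<..} < \<infinity>"
      by (subst em) (auto intro!: i)
    have fi: "integrable lborel (\<lambda>y. indicator {..x} y * f y)"
      by (rule Bochner_Integration.integrable_bound[OF f]) (auto simp: indicator_def)
    \<comment> \<open>Uniqueness of measures is available for upper rays, the hypothesis is about
      lower rays; the vanishing total integral \<open>t\<close> converts one into the other.\<close>
    have "(LINT y|lborel. indicator {x<..} y * ?p y) - (LINT y|lborel. indicator {x<..} y * ?n y) =
        (LINT y|lborel. f y - indicator {..x} y * f y)"
      by (subst Bochner_Integration.integral_diff[OF i(1) i(2), symmetric])
        (auto intro!: Bochner_Integration.integral_cong simp: indicator_def)
    also have "\<dots> = 0"
      using z[of x] t by (subst Bochner_Integration.integral_diff[OF f fi])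
        (simp add: set_lebesgue_integral_def)
    finally show "emeasure (density lborel (\<lambda>x. ennreal (?p x))) {x<..} =
        emeasure (density lborel (\<lambda>x. ennreal (?n x))) {x<..}"
      by (subst (1 2) em) (auto intro!: i)
  qed auto
  hence "AE x in lborel. ennreal (?p x) = ennreal (?n x)"
  proof (subst (asm) finite_density_unique)
    show "(\<integral>\<^sup>+ x. ennreal (?p x) \<partial>lborel) \<noteq> \<infinity>"
      using em[of UNIV ?p] i(1)[of UNIV] by (simp add: emeasure_density)
  qed auto
  thus ?thesis
    by eventually_elim (auto simp: max_def split: if_splits)
qed

section \<open>Trigonometric polynomials\<close>

text \<open>Integer frequencies let the product-to-sum formulas produce k - l without a case
  distinction on its sign.\<close>

inductive trig_poly :: "(real \<Rightarrow> real) \<Rightarrow> bool" where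
  cos: "trig_poly (\<lambda>x. cos (of_int k * x))"
| sin: "trig_poly (\<lambda>x. sin (of_int k * x))"
| add: "trig_poly f \<Longrightarrow> trig_poly g \<Longrightarrow> trig_poly (\<lambda>x. f x + g x)"
| scale: "trig_poly f \<Longrightarrow> trig_poly (\<lambda>x. c * f x)"

lemma trig_poly_const: "trig_poly (\<lambda>x. c)"
  using trig_poly.scale[OF trig_poly.cos[of 0], of c] by simp

lemma trig_poly_lin2:
  assumes "trig_poly f" "trig_poly g" "\<And>x. h x = c * f x + d * g x"
  shows "trig_poly h"
  using trig_poly.add[OF trig_poly.scale[OF assms(1), of c] trig_poly.scale[OF assms(2), of d]]
  by (simp add: assms(3)[abs_def])

text \<open>Product-to-sum formulas settle the generators; bilinearity carries this through both
  inductions.\<close>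

lemma trig_poly_mult:
  assumes "trig_poly f" "trig_poly g"
  shows "trig_poly (\<lambda>x. f x * g x)"
  using assms(1)
proof induction
  case (cos k)
  show ?case using assms(2)
  proof induction
    case (cos l)
    show ?case
      by (rule trig_poly_lin2[OF trig_poly.cos[of "k - l"] trig_poly.cos[of "k + l"], of _ "1/2" "1/2"])
        (simp add: cos_times_cos algebra_simps)
  next
    case (sin l)
    show ?case
      by (rule trig_poly_lin2[OF trig_poly.sin[of "k + l"] trig_poly.sin[of "k - l"], of _ "1/2" "-1/2"])
        (simp add: cos_times_sin left_diff_distrib distrib_right diff_divide_distrib)
  qed (auto simp: distrib_left mult.left_commute[of "cos _"] intro: trig_poly.intros)
next
  case (sin k)
  show ?case using assms(2)
  proof induction
    case (cos l)
    show ?case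
      by (rule trig_poly_lin2[OF trig_poly.sin[of "k + l"] trig_poly.sin[of "k - l"], of _ "1/2" "1/2"])
        (simp add: sin_times_cos left_diff_distrib distrib_right add_divide_distrib)
  next
    case (sin l)
    show ?case
      by (rule trig_poly_lin2[OF trig_poly.cos[of "k - l"] trig_poly.cos[of "k + l"], of _ "1/2" "-1/2"])
        (simp add: sin_times_sin left_diff_distrib distrib_right diff_divide_distrib)
  qed (auto simp: distrib_left mult.left_commute[of "sin _"] intro: trig_poly.intros)
qed (auto simp: distrib_right mult.assoc intro: trig_poly.intros)

lemma trig_poly_of_cos:
  fixes p :: "real \<Rightarrow> real"
  assumes "real_polynomial_function p"
  shows "trig_poly (\<lambda>x. p (cos x))"
  using assms
proof induction
  case (linear f)
  then obtain c where "f = (\<lambda>x. x * c)" using real_bounded_linear by auto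
  thus ?case using trig_poly.scale[OF trig_poly.cos[of 1], of c] by (simp add: mult.commute)
qed (auto intro: trig_poly_const trig_poly.add trig_poly_mult)

lemma trig_poly_periodic: "trig_poly f \<Longrightarrow> f (x + 2 * pi) = f x"
proof (induction arbitrary: x rule: trig_poly.induct)
  case (cos k)
  have "of_int k * (x + 2 * pi) = of_int k * x + of_int k * 2 * pi" by (simp add: algebra_simps)
  thus ?case using cos_int_2pin sin_int_2pin by (simp add: cos_add mult_ac)
next
  case (sin k)
  have "of_int k * (x + 2 * pi) = of_int k * x + of_int k * 2 * pi" by (simp add: algebra_simps)
  thus ?case using cos_int_2pin sin_int_2pin by (simp add: sin_add mult_ac)
qed auto

lemma trig_poly_deriv:
  "trig_poly f \<Longrightarrow> \<exists>f'. trig_poly f' \<and> (\<forall>x. (f has_real_derivative f' x) (at x))"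
proof (induction rule: trig_poly.induct)
  case (cos k)
  show ?case
    by (rule exI[of _ "\<lambda>x. - of_int k * sin (of_int k * x)"])
      (use trig_poly.scale[OF trig_poly.sin[of k], of "- of_int k"] in \<open>auto intro!: derivative_eq_intros\<close>)
next
  case (sin k)
  show ?case
    by (rule exI[of _ "\<lambda>x. of_int k * cos (of_int k * x)"])
      (auto intro!: trig_poly.scale trig_poly.cos derivative_eq_intros)
next
  case (add f g)
  then obtain f' g' where "trig_poly f'" "trig_poly g'"
    "\<And>x. (f has_real_derivative f' x) (at x)" "\<And>x. (g has_real_derivative g' x) (at x)"
    by blast
  thus ?case
    by (intro exI[of _ "\<lambda>x. f' x + g' x"]) (auto intro: trig_poly.add DERIV_add)
next
  case (scale f c)
  then obtain f' where "trig_poly f'" "\<And>x. (f has_real_derivative f' x) (at x)" by blast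
  thus ?case
    by (intro exI[of _ "\<lambda>x. c * f' x"]) (auto intro: trig_poly.scale DERIV_cmult)
qed

lemma trig_poly_continuous: "trig_poly f \<Longrightarrow> continuous_on S f"
  by (induction rule: trig_poly.induct) (auto intro!: continuous_intros)

lemma test_fun_per_trig_poly:
  assumes "trig_poly f"
  shows "test_fun_per f"
proof -
  have d: "trig_poly ((deriv ^^ n) f)" for n
  proof (induction n)
    case (Suc n)
    obtain g where "trig_poly g" "\<And>x. (((deriv ^^ n) f) has_real_derivative g x) (at x)"
      using trig_poly_deriv[OF Suc] by blast
    moreover from this(2) have "deriv ((deriv ^^ n) f) = g"
      by (intro ext DERIV_imp_deriv)
    ultimately show ?case by simp
  qed (use assms in simp)
  show ?thesis
    unfolding test_fun_per_def
    using trig_poly_periodic[OF assms] trig_poly_deriv[OF d] field_differentiable_def by blast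
qed

text \<open>Only the constant mode has no periodic primitive. The number c collects it: it is 1 for
  the cosine of frequency 0, and 0 for every other generator.\<close>

lemma trig_poly_antideriv:
  "trig_poly f \<Longrightarrow> \<exists>c F. trig_poly F \<and> (\<forall>x. (F has_real_derivative f x - c) (at x))"
proof (induction rule: trig_poly.induct)
  case (cos k)
  show ?case
  proof (cases "k = 0")
    case True
    show ?thesis
      by (rule exI[of _ 1], rule exI[of _ "\<lambda>_. 0"]) (simp add: True trig_poly_const)
  next
    case False
    have "trig_poly (\<lambda>x. (1 / of_int k) * sin (of_int k * x))"
      by (intro trig_poly.scale trig_poly.sin)
    thus ?thesis
      by (intro exI[of _ 0] exI[of _ "\<lambda>x. (1 / of_int k) * sin (of_int k * x)"])
        (use False in \<open>auto intro!: derivative_eq_intros\<close>)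
  qed
next
  case (sin k)
  show ?case
  proof (cases "k = 0")
    case True
    show ?thesis
      by (rule exI[of _ 0], rule exI[of _ "\<lambda>_. 0"]) (simp add: True trig_poly_const)
  next
    case False
    have "trig_poly (\<lambda>x. (- 1 / of_int k) * cos (of_int k * x))"
      by (intro trig_poly.scale trig_poly.cos)
    thus ?thesis
      by (intro exI[of _ 0] exI[of _ "\<lambda>x. (- 1 / of_int k) * cos (of_int k * x)"])
        (use False in \<open>auto intro!: derivative_eq_intros\<close>)
  qed
next
  case (add f g)
  then obtain c d F G where "trig_poly F" "trig_poly G"
    "\<And>x. (F has_real_derivative f x - c) (at x)" "\<And>x. (G has_real_derivative g x - d) (at x)"
    by blast
  thus ?case
    by (intro exI[of _ "c + d"] exI[of _ "\<lambda>x. F x + G x"])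
      (auto intro!: trig_poly.add derivative_eq_intros)
next
  case (scale f c)
  then obtain d F where "trig_poly F" "\<And>x. (F has_real_derivative f x - d) (at x)" by blast
  thus ?case
    by (intro exI[of _ "c * d"] exI[of _ "\<lambda>x. c * F x"])
      (auto intro!: trig_poly.scale derivative_eq_intros simp: algebra_simps)
qed

section \<open>Completeness of the trigonometric polynomials\<close>

lemma set_integrable_continuous_Icc:
  fixes f :: "real \<Rightarrow> real"
  shows "continuous_on {a..b} f \<Longrightarrow> set_integrable lborel {a..b} f"
  unfolding set_integrable_def by (rule borel_integrable_compact[OF compact_Icc])

lemma set_integral_reflect:
  fixes f :: "real \<Rightarrow> real"
  shows "(LINT x:{-a..a}|lborel. f (- x)) = (LINT x:{-a..a}|lborel. f x)"
  unfolding set_lebesgue_integral_def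
  by (subst lborel_integral_real_affine[of "-1" _ 0])
    (auto intro!: Bochner_Integration.integral_cong simp: indicator_def)

lemma continuous_zero_if_square_integral_zero:
  fixes f :: "real \<Rightarrow> real"
  assumes f: "continuous_on {a..b} f" and z: "(LINT x:{a..b}|lborel. f x * f x) = 0"
    and ab: "a < b" and x: "x \<in> {a..b}"
  shows "f x = 0"
proof -
  have c: "continuous_on {a..b} (\<lambda>x. f x * f x)" by (intro continuous_intros f)
  have "integral {a..b} (\<lambda>x. f x * f x) = 0"
    using z set_borel_integral_eq_integral(2)[OF set_integrable_continuous_Icc[OF c]] by simp
  hence "((\<lambda>x. f x * f x) has_integral 0) (cbox a b)"
    using integrable_continuous_real[OF c] by (metis integrable_integral box_real(2))
  thus ?thesis
    using has_integral_0_cbox_imp_0[of a b "\<lambda>x. f x * f x" x] c ab x by (auto simp: box_real)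
qed

text \<open>An even function is a continuous function of $\cos x$, to which the Weierstrass theorem on
  $[-1, 1]$ applies.\<close>

lemma even_continuous_zero:
  fixes f :: "real \<Rightarrow> real"
  assumes f: "continuous_on {-pi..pi} f" and even: "\<And>x. x \<in> {-pi..pi} \<Longrightarrow> f (- x) = f x"
    and orth: "\<And>p. real_polynomial_function p \<Longrightarrow> (LINT x:{-pi..pi}|lborel. f x * p (cos x)) = 0"
    and x: "x \<in> {-pi..pi}"
  shows "f x = 0"
proof -
  have c: "continuous_on {-1..1} (\<lambda>y. f (arccos y))"
  proof (rule continuous_on_compose2[OF f continuous_on_arccos'])
    show "arccos ` {-1..1} \<subseteq> {-pi..pi}"
      using arccos_lbound arccos_ubound pi_ge_zero by (force intro: order_trans[of "-pi" 0])
  qed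
  \<comment> \<open>\<open>arccos\<close> inverts the cosine only on [0, pi]; evenness of f covers
    the negative half.\<close>
  have fc: "f (arccos (cos x)) = f x" if "x \<in> {-pi..pi}" for x
    using that even[of x] by (cases "x \<ge> 0") (auto simp: arccos_cos arccos_cos2)
  let ?I = "LINT x:{-pi..pi}|lborel. f x * f x" and ?J = "LINT x:{-pi..pi}|lborel. \<bar>f x\<bar>"
  have J: "?J \<ge> 0"
    unfolding set_lebesgue_integral_def by (rule Bochner_Integration.integral_nonneg) simp
  have "?I \<le> e" if "e > 0" for e
  proof -
    \<comment> \<open>By orthogonality the integral of f^2 equals that of f (f - p(cos x)), at most
      J times the approximation error. Dividing by J + 1 instead of J keeps the tolerance meaningful
      when J = 0.\<close>
    have "e / (?J + 1) > 0" using that J by simp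
    then obtain p where p: "real_polynomial_function p"
      "\<And>y. y \<in> {-1..1} \<Longrightarrow> \<bar>f (arccos y) - p y\<bar> < e / (?J + 1)"
      using Stone_Weierstrass_real_polynomial_function[OF compact_Icc c] by blast
    have cp: "continuous_on {-pi..pi} (\<lambda>x. p (cos x))"
      by (rule trig_poly_continuous[OF trig_poly_of_cos[OF p(1)]])
    have "?I = (LINT x:{-pi..pi}|lborel. f x * f x) - (LINT x:{-pi..pi}|lborel. f x * p (cos x))"
      using orth[OF p(1)] by simp
    also have "\<dots> = (LINT x:{-pi..pi}|lborel. f x * f x - f x * p (cos x))"
      by (intro set_integral_diff(2)[symmetric] set_integrable_continuous_Icc continuous_intros f cp)
    also have "\<dots> \<le> (LINT x:{-pi..pi}|lborel. \<bar>f x\<bar> * (e / (?J + 1)))"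
    proof (rule set_integral_mono)
      fix x :: real assume x: "x \<in> {-pi..pi}"
      have "\<bar>f x - p (cos x)\<bar> \<le> e / (?J + 1)"
        using p(2)[of "cos x"] fc[OF x] by simp
      hence "\<bar>f x\<bar> * \<bar>f x - p (cos x)\<bar> \<le> \<bar>f x\<bar> * (e / (?J + 1))"
        by (rule mult_left_mono) simp
      thus "f x * f x - f x * p (cos x) \<le> \<bar>f x\<bar> * (e / (?J + 1))"
        unfolding right_diff_distrib[symmetric] using abs_ge_self[of "f x * (f x - p (cos x))"]
        by (simp only: abs_mult)
    qed (intro set_integrable_continuous_Icc continuous_intros f cp)+
    also have "\<dots> = ?J * (e / (?J + 1))"
      by simp
    also have "\<dots> \<le> e"
      using J that by (simp add: field_simps)
    finally show ?thesis .
  qed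
  hence "?I \<le> 0" by (rule field_le_epsilon[of ?I 0, simplified])
  moreover have "?I \<ge> 0"
    unfolding set_lebesgue_integral_def by (rule Bochner_Integration.integral_nonneg) simp
  ultimately show ?thesis
    using continuous_zero_if_square_integral_zero[OF f _ _ x] by simp
qed

text \<open>The even part of f falls under \<open>even_continuous_zero\<close> directly. The odd
  part becomes even after multiplication by sin, which keeps trigonometric polynomials as test
  functions. Cancelling sin works away from 0 and the endpoints, and continuity fills in these three
  points.\<close>

lemma continuous_orthogonal_trig_poly_zero:
  fixes f :: "real \<Rightarrow> real"
  assumes f: "continuous_on {-pi..pi} f"
    and orth: "\<And>\<psi>. trig_poly \<psi> \<Longrightarrow> (LINT x:{-pi..pi}|lborel. f x * \<psi> x) = 0"
    and x: "x \<in> {-pi..pi}"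
  shows "f x = 0"
proof -
  have fm: "continuous_on {-pi..pi} (\<lambda>x. f (- x))"
    by (rule continuous_on_compose2[OF f]) (auto intro!: continuous_intros)
  have orth': "(LINT x:{-pi..pi}|lborel. f (- x) * \<psi> x) = 0" if "trig_poly \<psi>" "trig_poly (\<lambda>x. \<psi> (- x))" for \<psi>
    using set_integral_reflect[of pi "\<lambda>x. f x * \<psi> (- x)"] orth[OF that(2)] by simp
  have pe: "f y + f (- y) = 0" if "y \<in> {-pi..pi}" for y
  proof (rule even_continuous_zero[OF _ _ _ that, of "\<lambda>y. f y + f (- y)"])
    fix p :: "real \<Rightarrow> real" assume p: "real_polynomial_function p"
    have t: "trig_poly (\<lambda>x. p (cos x))" by (rule trig_poly_of_cos[OF p])
    have "(LINT x:{-pi..pi}|lborel. f x * p (cos x) + f (- x) * p (cos x)) =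
      (LINT x:{-pi..pi}|lborel. f x * p (cos x)) + (LINT x:{-pi..pi}|lborel. f (- x) * p (cos x))"
      by (intro set_integral_add(2) set_integrable_continuous_Icc continuous_intros f fm
          trig_poly_continuous[OF t])
    thus "(LINT x:{-pi..pi}|lborel. (f x + f (- x)) * p (cos x)) = 0"
      using orth[OF t] orth'[of "\<lambda>x. p (cos x)"] t by (simp add: distrib_right)
  qed (auto intro!: continuous_intros f fm)
  have po: "(f y - f (- y)) * sin y = 0" if "y \<in> {-pi..pi}" for y
  proof (rule even_continuous_zero[OF _ _ _ that, of "\<lambda>y. (f y - f (- y)) * sin y"])
    fix p :: "real \<Rightarrow> real" assume p: "real_polynomial_function p"
    have t: "trig_poly (\<lambda>x. sin x * p (cos x))"
      using trig_poly_mult[OF trig_poly.sin[of 1] trig_poly_of_cos[OF p]] by simp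
    have t': "trig_poly (\<lambda>x. sin (- x) * p (cos (- x)))"
      using trig_poly.scale[OF t, of "-1"] by simp
    have "(LINT x:{-pi..pi}|lborel. f x * (sin x * p (cos x)) - f (- x) * (sin x * p (cos x))) =
      (LINT x:{-pi..pi}|lborel. f x * (sin x * p (cos x))) - (LINT x:{-pi..pi}|lborel. f (- x) * (sin x * p (cos x)))"
      by (intro set_integral_diff(2) set_integrable_continuous_Icc continuous_on_mult f fm
          trig_poly_continuous[OF t])
    thus "(LINT x:{-pi..pi}|lborel. (f x - f (- x)) * sin x * p (cos x)) = 0"
      using orth[OF t] orth'[OF t t'] by (simp add: left_diff_distrib mult.assoc)
  qed (auto intro!: continuous_intros f fm simp: algebra_simps)
  have int: "f y = 0" if y: "-pi < y" "y < pi" "y \<noteq> 0" for y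
  proof -
    have "sin y \<noteq> 0"
      using y sin_gt_zero[of y] sin_gt_zero[of "- y"] by (cases "y > 0") auto
    thus ?thesis using po[of y] pe[of y] y by simp
  qed
  have "x \<in> closure ({-pi<..<0} \<union> {0<..<pi})"
    using x by (auto simp: closure_Un)
  moreover have "continuous_on (closure ({-pi<..<0} \<union> {0<..<pi})) f"
    by (rule continuous_on_subset[OF f]) (auto simp: closure_Un)
  ultimately show ?thesis
    using continuous_constant_on_closure[of "{-pi<..<0} \<union> {0<..<pi}" f 0 x] int by fastforce
qed

text \<open>Integration lifts the question to a continuous function: if f is orthogonal to all
  trigonometric polynomials, its primitive G is orthogonal to all their derivatives, hence to those
  of mean zero. Then G minus its mean is orthogonal to all of them, so G is constant, and G vanishes
  at -pi.\<close>

lemma orthogonal_trig_poly_zero: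
  fixes f :: "real \<Rightarrow> real"
  assumes f: "set_integrable lborel {-pi..pi} f"
    and orth: "\<And>\<psi>. trig_poly \<psi> \<Longrightarrow> (LINT x:{-pi..pi}|lborel. f x * \<psi> x) = 0"
  shows "AE x in lborel. x \<in> {-pi..pi} \<longrightarrow> f x = 0"
proof -
  define G where "G x = (LINT y:{-pi..x}|lborel. f y)" for x
  have G0: "G (-pi) = 0"
    unfolding G_def set_lebesgue_integral_def
    by (rule integral_eq_zero_AE) (use AE_lborel_singleton[of "-pi"] in \<open>auto elim: AE_mp\<close>)
  have G: "ac_on (-pi) pi G f"
    using f G0 by (simp add: ac_on_def) (simp add: G_def)
  \<comment> \<open>Testing with the constant 1 removes the second boundary term.\<close>
  have Gpi: "G pi = 0"
    using orth[OF trig_poly_const[of 1]] by (simp add: G_def)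
  note Gc = ac_on_continuous[OF G]
  have o: "(LINT x:{-pi..pi}|lborel. G x * \<psi> x) = 0" if "trig_poly \<psi>" and p: "trig_poly \<Psi>" and
    d: "\<And>x. (\<Psi> has_real_derivative \<psi> x) (at x)" for \<psi> \<Psi>
  proof -
    have "ac_on (-pi) pi \<Psi> \<psi>"
      by (intro ac_on_DERIV d trig_poly_continuous[OF that(1)])
    from ac_on_parts[OF G this] have
      "(LINT x:{-pi..pi}|lborel. f x * \<Psi> x + G x * \<psi> x) = 0"
      by (simp add: G0 Gpi)
    thus ?thesis
      using set_integral_add(2)[OF set_integrable_mult_continuous[OF f trig_poly_continuous[OF p]]
          set_integrable_continuous_Icc[OF continuous_on_mult[OF Gc trig_poly_continuous[OF that(1)]]]]
        orth[OF p] by simp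
  qed
  define m where "m = (LINT x:{-pi..pi}|lborel. G x) / (2 * pi)"
  have H: "G x - m = 0" if "x \<in> {-pi..pi}" for x
  proof (rule continuous_orthogonal_trig_poly_zero[OF _ _ that, of "\<lambda>x. G x - m"])
    fix \<psi> assume \<psi>: "trig_poly \<psi>"
    obtain c \<Psi> where \<Psi>: "trig_poly \<Psi>" "\<And>x. (\<Psi> has_real_derivative \<psi> x - c) (at x)"
      using trig_poly_antideriv[OF \<psi>] by blast
    have tc: "trig_poly (\<lambda>x. \<psi> x - c)"
      using trig_poly.add[OF \<psi> trig_poly_const[of "-c"]] by simp
    have "(LINT x:{-pi..pi}|lborel. \<psi> x - c) = \<Psi> pi - \<Psi> (-pi)"
      by (rule ac_on_integral[OF ac_on_DERIV[OF \<Psi>(2) trig_poly_continuous[OF tc]]]) simp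
    also have "\<dots> = 0" using trig_poly_periodic[OF \<Psi>(1), of "-pi"] by simp
    finally have z: "(LINT x:{-pi..pi}|lborel. \<psi> x - c) = 0" .
    have mm: "(LINT x:{-pi..pi}|lborel. m) = (LINT x:{-pi..pi}|lborel. G x)"
      by (simp add: m_def set_lebesgue_integral_def)
    have i: "set_integrable lborel {-pi..pi} (\<lambda>x. G x * (\<psi> x - c))"
      "set_integrable lborel {-pi..pi} (\<lambda>x. m * (\<psi> x - c))"
      "set_integrable lborel {-pi..pi} (\<lambda>x. c * G x)" "set_integrable lborel {-pi..pi} (\<lambda>x. c * m)"
      by (intro set_integrable_continuous_Icc continuous_intros Gc trig_poly_continuous[OF \<psi>])+
    \<comment> \<open>Here psi is split into psi - c, the derivative of a trigonometric polynomial,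
      and the constant c. The first part is handled by \<open>o\<close> and \<open>z\<close>, the
      second by the choice of m as the mean of G.\<close>
    have "(LINT x:{-pi..pi}|lborel. (G x - m) * \<psi> x) =
      (LINT x:{-pi..pi}|lborel. (G x * (\<psi> x - c) - m * (\<psi> x - c)) + (c * G x - c * m))"
      by (simp add: algebra_simps)
    also have "\<dots> = (LINT x:{-pi..pi}|lborel. G x * (\<psi> x - c)) - m * (LINT x:{-pi..pi}|lborel. \<psi> x - c)
      + (c * (LINT x:{-pi..pi}|lborel. G x) - c * (LINT x:{-pi..pi}|lborel. m))"
      by (simp only: set_integral_add(2)[OF set_integral_diff(1)[OF i(1,2)] set_integral_diff(1)[OF i(3,4)]]
          set_integral_diff(2)[OF i(1,2)] set_integral_diff(2)[OF i(3,4)]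
          set_integral_mult_right)
    also have "\<dots> = 0" using z mm o[OF tc \<Psi>] by simp
    finally show "(LINT x:{-pi..pi}|lborel. (G x - m) * \<psi> x) = 0" .
  qed (auto intro!: continuous_intros Gc)
  have Gz: "G x = 0" if "x \<in> {-pi..pi}" for x
    using H[OF that] H[of "-pi"] G0 by simp
  have "AE x in lborel. indicator {-pi..pi} x * f x = 0"
  proof (rule AE_zero_of_indefinite_integral_zero)
    show "integrable lborel (\<lambda>x. indicator {-pi..pi} x * f x)"
      using f by (simp add: set_integrable_def)
    show "(LINT y|lborel. indicator {-pi..pi} y * f y) = 0"
      using Gpi by (simp add: G_def set_lebesgue_integral_def)
    fix x
    show "(LINT y:{..x}|lborel. indicator {-pi..pi} y * f y) = 0"
    proof (cases "x < -pi")
      case True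
      hence "indicator {..x} y *\<^sub>R (indicator {-pi..pi} y * f y) = 0" for y
        by (simp add: indicator_def)
      thus ?thesis by (simp only: set_lebesgue_integral_def Bochner_Integration.integral_zero)
    next
      case False
      have "(LINT y:{..x}|lborel. indicator {-pi..pi} y * f y) = G (min x pi)"
        unfolding set_lebesgue_integral_def G_def
        by (intro Bochner_Integration.integral_cong) (auto simp: indicator_def)
      thus ?thesis
        using Gz[of "min x pi"] False by simp
    qed
  qed
  thus ?thesis by eventually_elim (auto simp: indicator_def)
qed

section \<open>Weak derivatives of periodic functions\<close>

lemma L2per_rel_refl_iff: "L2per_rel f f \<longleftrightarrow> f \<in> sq_integrable_per"
  by (auto simp: L2per_rel_def)

lemma L2per_cases:
  obtains f where "f \<in> sq_integrable_per" "v = abs_L2per f"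
proof
  show "rep_L2per v \<in> sq_integrable_per"
    using Quotient_rep_reflp[OF Quotient_L2per] by (simp add: L2per_rel_refl_iff)
  show "v = abs_L2per (rep_L2per v)"
    using Quotient_abs_rep[OF Quotient_L2per] by simp
qed

lemma abs_L2per_eqI:
  assumes "f \<in> sq_integrable_per" "g \<in> sq_integrable_per"
    "AE x in lborel. x \<in> {-pi..pi} \<longrightarrow> f x = g x"
  shows "abs_L2per f = abs_L2per g"
  using Quotient_rel_abs[OF Quotient_L2per] assms by (simp add: L2per_rel_def)

lemma inner_abs_L2per:
  "f \<in> sq_integrable_per \<Longrightarrow> g \<in> sq_integrable_per \<Longrightarrow>
    inner (abs_L2per f) (abs_L2per g) = (LINT x:{-pi..pi}|lborel. f x * g x)"
  by (simp add: inner_L2per.abs_eq L2per_rel_refl_iff)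

lemma has_weak_deriv_abs_L2per:
  "f \<in> sq_integrable_per \<Longrightarrow> g \<in> sq_integrable_per \<Longrightarrow>
    has_weak_deriv (abs_L2per f) (abs_L2per g) \<longleftrightarrow> (\<forall>\<phi>. test_fun_per \<phi> \<longrightarrow>
     (LINT x:{-pi..pi}|lborel. f x * deriv \<phi> x) = - (LINT x:{-pi..pi}|lborel. g x * \<phi> x))"
  by (simp add: has_weak_deriv.abs_eq L2per_rel_refl_iff)

lemma sq_integrable_per_set_integrable:
  assumes "f \<in> sq_integrable_per"
  shows "set_integrable lborel {-pi..pi} f"
  using sq_integrable_per_integrable_mult[OF assms, of "\<lambda>_. 1"]
  by (simp add: sq_integrable_per_def set_integrable_def)

lemma test_fun_per_DERIV:
  assumes "test_fun_per \<phi>"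
  shows "(\<phi> has_real_derivative deriv \<phi> x) (at x)"
    and "continuous_on S \<phi>" and "continuous_on S (deriv \<phi>)"
proof -
  have d: "((deriv ^^ n) \<phi>) field_differentiable (at x)" for n x
    using assms by (simp add: test_fun_per_def)
  show "(\<phi> has_real_derivative deriv \<phi> x) (at x)"
    using d[of 0] by (simp add: DERIV_deriv_iff_field_differentiable)
  have "continuous_on S ((deriv ^^ n) \<phi>)" for n
    by (intro continuous_at_imp_continuous_on ballI field_differentiable_imp_continuous_at d)
  from this[of 0] this[of 1] show "continuous_on S \<phi>" "continuous_on S (deriv \<phi>)" by simp_all
qed

lemma test_fun_per_ac_on: "test_fun_per \<phi> \<Longrightarrow> ac_on a b \<phi> (deriv \<phi>)"
  by (intro ac_on_DERIV test_fun_per_DERIV)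

lemma test_fun_per_ends: "test_fun_per \<phi> \<Longrightarrow> \<phi> pi = \<phi> (- pi)"
  unfolding test_fun_per_def by (drule conjunct1, drule spec[of _ "-pi"]) simp

lemma set_integral_cong_AE_Icc:
  fixes f g :: "real \<Rightarrow> real"
  assumes ae: "AE x in lborel. x \<in> {a..b} \<longrightarrow> f x = g x"
    and f: "set_integrable lborel {a..b} f" and g: "set_integrable lborel {a..b} g"
  shows "(LINT x:{a..b}|lborel. f x) = (LINT x:{a..b}|lborel. g x)"
  unfolding set_lebesgue_integral_def
proof (rule integral_cong_AE)
  show "AE x in lborel. indicator {a..b} x *\<^sub>R f x = indicator {a..b} x *\<^sub>R g x"
    using ae by eventually_elim (auto simp: indicator_def)
qed (use f g in \<open>auto simp: set_integrable_def intro: borel_measurable_integrable\<close>)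

lemma ac_on_weak_deriv:
  assumes U: "ac_on (-pi) pi U g" and per: "U pi = U (-pi)" and \<phi>: "test_fun_per \<phi>"
  shows "(LINT x:{-pi..pi}|lborel. U x * deriv \<phi> x) = - (LINT x:{-pi..pi}|lborel. g x * \<phi> x)"
proof -
  have g: "set_integrable lborel {-pi..pi} g" using U by (simp add: ac_on_def)
  have "(LINT x:{-pi..pi}|lborel. g x * \<phi> x + U x * deriv \<phi> x) = 0"
    by (subst ac_on_parts[OF U test_fun_per_ac_on[OF \<phi>]]) (simp_all add: per test_fun_per_ends[OF \<phi>])
  also have "(LINT x:{-pi..pi}|lborel. g x * \<phi> x + U x * deriv \<phi> x) =
    (LINT x:{-pi..pi}|lborel. g x * \<phi> x) + (LINT x:{-pi..pi}|lborel. U x * deriv \<phi> x)"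
    by (intro set_integral_add(2) set_integrable_mult_continuous[OF g] set_integrable_continuous_Icc
        continuous_on_mult ac_on_continuous[OF U] test_fun_per_DERIV[OF \<phi>])
  finally show ?thesis by simp
qed

text \<open>Two functions h and U occur because U is controlled only on the interval, whereas a
  representative of a class has to be Borel and periodic on the whole line.\<close>

lemma has_weak_deriv_of_ac_on:
  assumes h: "h \<in> sq_integrable_per" and g: "g \<in> sq_integrable_per"
    and U: "ac_on (-pi) pi U g" and per: "U pi = U (-pi)"
    and hU: "AE x in lborel. x \<in> {-pi..pi} \<longrightarrow> h x = U x"
  shows "has_weak_deriv (abs_L2per h) (abs_L2per g)"
  unfolding has_weak_deriv_abs_L2per[OF h g]
proof (intro allI impI)
  fix \<phi> assume \<phi>: "test_fun_per \<phi>"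
  have "(LINT x:{-pi..pi}|lborel. h x * deriv \<phi> x) = (LINT x:{-pi..pi}|lborel. U x * deriv \<phi> x)"
  proof (rule set_integral_cong_AE_Icc)
    show "AE x in lborel. x \<in> {-pi..pi} \<longrightarrow> h x * deriv \<phi> x = U x * deriv \<phi> x"
      using hU by eventually_elim simp
  qed (intro set_integrable_mult_continuous[OF sq_integrable_per_set_integrable[OF h]]
      set_integrable_continuous_Icc continuous_on_mult ac_on_continuous[OF U] test_fun_per_DERIV[OF \<phi>])+
  thus "(LINT x:{-pi..pi}|lborel. h x * deriv \<phi> x) = - (LINT x:{-pi..pi}|lborel. g x * \<phi> x)"
    by (simp add: ac_on_weak_deriv[OF U per \<phi>])
qed

text \<open>The constant 1 is a periodic test function with derivative 0. This is what makes
  indefinite integrals of weak derivatives take equal values at the two endpoints.\<close>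

lemma has_weak_deriv_integral_zero:
  assumes F: "F \<in> sq_integrable_per" and g: "g \<in> sq_integrable_per"
    and wd: "has_weak_deriv (abs_L2per F) (abs_L2per g)"
  shows "(LINT x:{-pi..pi}|lborel. g x) = 0"
proof -
  have "test_fun_per (\<lambda>_. 1)" by (intro test_fun_per_trig_poly trig_poly_const)
  hence "(LINT x:{-pi..pi}|lborel. F x * deriv (\<lambda>_. 1) x) = - (LINT x:{-pi..pi}|lborel. g x * 1)"
    using wd unfolding has_weak_deriv_abs_L2per[OF F g] by blast
  thus ?thesis by simp
qed

lemma ac_on_indefinite_integral:
  assumes f: "set_integrable lborel {a..b} f"
  shows "ac_on a b (\<lambda>x. c + (LINT y:{a..x}|lborel. f y)) f"
proof -
  have "(LINT y:{a..a}|lborel. f y) = 0"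
    unfolding set_lebesgue_integral_def
    by (rule integral_eq_zero_AE) (use AE_lborel_singleton[of a] in \<open>auto elim: AE_mp\<close>)
  thus ?thesis using f by (simp add: ac_on_def)
qed

text \<open>An indefinite integral U of g has the same weak derivative as F, so F - U is orthogonal
  to the derivatives of all test functions, in particular to all trigonometric polynomials of mean
  zero. Adjusting U by a constant makes F - U orthogonal to constants too, and completeness gives F
  = U almost everywhere.\<close>

lemma has_weak_deriv_imp_ac_on:
  assumes F: "F \<in> sq_integrable_per" and g: "g \<in> sq_integrable_per"
    and wd: "has_weak_deriv (abs_L2per F) (abs_L2per g)"
  obtains U where "ac_on (-pi) pi U g" "U pi = U (-pi)"
    "AE x in lborel. x \<in> {-pi..pi} \<longrightarrow> F x = U x"
proof -
  note Fi = sq_integrable_per_set_integrable[OF F] and gi = sq_integrable_per_set_integrable[OF g]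
  define U0 where "U0 x = (LINT y:{-pi..x}|lborel. g y)" for x
  have "ac_on (-pi) pi U0 g"
    using ac_on_indefinite_integral[OF gi, of 0] by (simp add: U0_def[abs_def])
  note U0i = set_integrable_continuous_Icc[OF ac_on_continuous[OF this]]
  \<comment> \<open>This value gives U the same integral as F.\<close>
  define m where "m = ((LINT x:{-pi..pi}|lborel. F x) - (LINT x:{-pi..pi}|lborel. U0 x)) / (2 * pi)"
  define U where "U x = m + U0 x" for x
  have U: "ac_on (-pi) pi U g"
    unfolding U_def[abs_def] U0_def[abs_def] by (rule ac_on_indefinite_integral[OF gi])
  have per: "U pi = U (-pi)"
    using ac_on_integral[OF U] has_weak_deriv_integral_zero[OF F g wd] by simp
  have mi: "set_integrable lborel {-pi..pi} (\<lambda>_. m)"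
    by (intro set_integrable_continuous_Icc continuous_intros)
  have Ui: "set_integrable lborel {-pi..pi} U"
    by (intro set_integrable_continuous_Icc ac_on_continuous[OF U])
  have FUi: "set_integrable lborel {-pi..pi} (\<lambda>x. F x - U x)"
    by (intro set_integral_diff Fi Ui)
  have mean: "(LINT x:{-pi..pi}|lborel. F x - U x) = 0"
  proof -
    have "(LINT x:{-pi..pi}|lborel. U x) = (LINT x:{-pi..pi}|lborel. m) + (LINT x:{-pi..pi}|lborel. U0 x)"
      unfolding U_def by (intro set_integral_add mi U0i)
    also have "(LINT x:{-pi..pi}|lborel. m) = 2 * pi * m"
      by (simp add: set_lebesgue_integral_def)
    finally have "(LINT x:{-pi..pi}|lborel. U x) = (LINT x:{-pi..pi}|lborel. F x)"
      by (simp add: m_def)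
    thus ?thesis by (simp add: set_integral_diff(2)[OF Fi Ui])
  qed
  have "AE x in lborel. x \<in> {-pi..pi} \<longrightarrow> F x - U x = 0"
  proof (rule orthogonal_trig_poly_zero[OF FUi])
    fix \<psi> assume \<psi>: "trig_poly \<psi>"
    obtain c \<Psi> where \<Psi>: "trig_poly \<Psi>" "\<And>x. (\<Psi> has_real_derivative \<psi> x - c) (at x)"
      using trig_poly_antideriv[OF \<psi>] by blast
    have d: "deriv \<Psi> = (\<lambda>x. \<psi> x - c)"
      using \<Psi>(2) by (intro ext DERIV_imp_deriv)
    have T: "test_fun_per \<Psi>" by (rule test_fun_per_trig_poly[OF \<Psi>(1)])
    note dc = test_fun_per_DERIV(3)[OF T]
    have "(LINT x:{-pi..pi}|lborel. (F x - U x) * \<psi> x) =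
        (LINT x:{-pi..pi}|lborel. (F x * deriv \<Psi> x - U x * deriv \<Psi> x) + c * (F x - U x))"
      by (simp add: d algebra_simps)
    also have "\<dots> = (LINT x:{-pi..pi}|lborel. F x * deriv \<Psi> x - U x * deriv \<Psi> x) +
        (LINT x:{-pi..pi}|lborel. c * (F x - U x))"
      by (intro set_integral_add(2) set_integral_diff(1) set_integrable_mult_continuous Fi Ui dc
          set_integrable_mult_right FUi)
    also have "(LINT x:{-pi..pi}|lborel. F x * deriv \<Psi> x - U x * deriv \<Psi> x) =
        (LINT x:{-pi..pi}|lborel. F x * deriv \<Psi> x) - (LINT x:{-pi..pi}|lborel. U x * deriv \<Psi> x)"
      by (intro set_integral_diff(2) set_integrable_mult_continuous Fi Ui dc)
    also have "\<dots> = 0"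
      using wd T ac_on_weak_deriv[OF U per T] by (simp add: has_weak_deriv_abs_L2per[OF F g])
    finally show "(LINT x:{-pi..pi}|lborel. (F x - U x) * \<psi> x) = 0"
      by (simp add: mean)
  qed
  thus thesis
    by (intro that[OF U per]) simp
qed

section \<open>Uniqueness of weak derivatives, existence and uniqueness of zero-mean
  antiderivatives\<close>

lemma has_weak_deriv_unique:
  assumes "has_weak_deriv F g" "has_weak_deriv F h"
  shows "g = h"
proof -
  obtain F' where F': "F' \<in> sq_integrable_per" "F = abs_L2per F'" by (rule L2per_cases)
  obtain g' where g': "g' \<in> sq_integrable_per" "g = abs_L2per g'" by (rule L2per_cases)
  obtain h' where h': "h' \<in> sq_integrable_per" "h = abs_L2per h'" by (rule L2per_cases)
  note gi = sq_integrable_per_set_integrable[OF g'(1)]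
    and hi = sq_integrable_per_set_integrable[OF h'(1)]
  note wd = assms(1)[unfolded F'(2) g'(2) has_weak_deriv_abs_L2per[OF F'(1) g'(1)]]
    assms(2)[unfolded F'(2) h'(2) has_weak_deriv_abs_L2per[OF F'(1) h'(1)]]
  have "AE x in lborel. x \<in> {-pi..pi} \<longrightarrow> g' x - h' x = 0"
  proof (rule orthogonal_trig_poly_zero[OF set_integral_diff(1)[OF gi hi]])
    fix \<psi> assume \<psi>: "trig_poly \<psi>"
    have "(LINT x:{-pi..pi}|lborel. (g' x - h' x) * \<psi> x) =
        (LINT x:{-pi..pi}|lborel. g' x * \<psi> x) - (LINT x:{-pi..pi}|lborel. h' x * \<psi> x)"
      unfolding left_diff_distrib
      by (intro set_integral_diff(2) set_integrable_mult_continuous gi hi trig_poly_continuous[OF \<psi>])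
    also have "\<dots> = 0"
      using wd(1)[rule_format, OF test_fun_per_trig_poly[OF \<psi>]]
        wd(2)[rule_format, OF test_fun_per_trig_poly[OF \<psi>]] by simp
    finally show "(LINT x:{-pi..pi}|lborel. (g' x - h' x) * \<psi> x) = 0" .
  qed
  thus ?thesis unfolding g'(2) h'(2)
    by (intro abs_L2per_eqI g'(1) h'(1)) simp
qed

lemma dz_eqI: "has_weak_deriv F g \<Longrightarrow> dz F = g"
  unfolding dz_def using has_weak_deriv_unique by blast

lemma has_weak_deriv_scaleR:
  assumes "has_weak_deriv F g"
  shows "has_weak_deriv (c *\<^sub>R F) (c *\<^sub>R g)"
  using assms by transfer (simp add: mult.assoc)

lemma L2per_zero_mean_abs_L2per:
  "f \<in> sq_integrable_per \<Longrightarrow>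
    abs_L2per f \<in> L2per_zero_mean \<longleftrightarrow> (LINT x:{-pi..pi}|lborel. f x) = 0"
  by (simp add: L2per_zero_mean_def L2per_integral.abs_eq L2per_rel_refl_iff)

text \<open>Both are almost everywhere indefinite integrals of the same function, so they differ by
  a constant, which the zero means force to be 0.\<close>

lemma weak_antideriv_unique:
  assumes "F \<in> L2per_zero_mean" "has_weak_deriv F g" "G \<in> L2per_zero_mean" "has_weak_deriv G g"
  shows "F = G"
proof -
  obtain F' where F': "F' \<in> sq_integrable_per" "F = abs_L2per F'" by (rule L2per_cases)
  obtain G' where G': "G' \<in> sq_integrable_per" "G = abs_L2per G'" by (rule L2per_cases)
  obtain g' where g': "g' \<in> sq_integrable_per" "g = abs_L2per g'" by (rule L2per_cases)
  obtain U where U: "ac_on (-pi) pi U g'" "AE x in lborel. x \<in> {-pi..pi} \<longrightarrow> F' x = U x"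
    using has_weak_deriv_imp_ac_on[OF F'(1) g'(1)] assms(2) F'(2) g'(2) by metis
  obtain V where V: "ac_on (-pi) pi V g'" "AE x in lborel. x \<in> {-pi..pi} \<longrightarrow> G' x = V x"
    using has_weak_deriv_imp_ac_on[OF G'(1) g'(1)] assms(4) G'(2) g'(2) by metis
  define c where "c = U (-pi) - V (-pi)"
  have UV: "U x - V x = c" if "x \<in> {-pi..pi}" for x
  proof -
    have "U x - U (-pi) = V x - V (-pi)"
      using U(1) V(1) that by (simp add: ac_on_def)
    thus ?thesis by (simp add: c_def)
  qed
  from U(2) V(2) have ae: "AE x in lborel. x \<in> {-pi..pi} \<longrightarrow> F' x - G' x = c"
    by eventually_elim (use UV in auto)
  note Fi = sq_integrable_per_set_integrable[OF F'(1)]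
    and Gi = sq_integrable_per_set_integrable[OF G'(1)]
  have "(LINT x:{-pi..pi}|lborel. F' x - G' x) = (LINT x:{-pi..pi}|lborel. c)"
    by (intro set_integral_cong_AE_Icc ae set_integral_diff(1) Fi Gi
        set_integrable_continuous_Icc continuous_intros)
  moreover have "(LINT x:{-pi..pi}|lborel. F' x - G' x) = 0"
    using assms(1,3) unfolding F'(2) G'(2)
    by (simp add: L2per_zero_mean_abs_L2per F' G' set_integral_diff(2)[OF Fi Gi])
  ultimately have "c = 0" by (simp add: set_lebesgue_integral_def)
  thus ?thesis unfolding F'(2) G'(2)
    using ae by (intro abs_L2per_eqI F' G') simp
qed

lemma per_ext_eq:
  assumes "-pi \<le> x" "x < pi"
  shows "per_ext G x = G x"
proof -
  have "\<lfloor>(x + pi) / (2 * pi)\<rfloor> = 0"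
    using assms by (simp add: floor_eq_iff field_simps)
  thus ?thesis by (simp add: per_ext_def)
qed

lemma per_ext_periodic: "per_ext G (x + 2 * pi) = per_ext G x"
proof -
  have "(x + 2 * pi + pi) / (2 * pi) = (x + pi) / (2 * pi) + 1"
    by (simp add: field_simps)
  hence "\<lfloor>(x + 2 * pi + pi) / (2 * pi)\<rfloor> = \<lfloor>(x + pi) / (2 * pi)\<rfloor> + 1"
    by simp
  thus ?thesis by (simp add: per_ext_def algebra_simps)
qed

text \<open>\<open>per_ext\<close> reproduces its argument on the half-open period only: at pi it
  takes the value at -pi. The null set {pi} absorbs the discrepancy.\<close>

lemma AE_Icc_if_Ico:
  assumes "\<And>x :: real. a \<le> x \<Longrightarrow> x < b \<Longrightarrow> P x"
  shows "AE x in lborel. x \<in> {a..b} \<longrightarrow> P x"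
  using AE_lborel_singleton[of b] by eventually_elim (auto intro: assms)

lemma sq_integrable_per_continuous:
  assumes G: "continuous_on {-pi..pi} G"
  obtains h where "h \<in> sq_integrable_per" "AE x in lborel. x \<in> {-pi..pi} \<longrightarrow> h x = G x"
proof
  \<comment> \<open>Nothing is known about G outside the interval, so it is cut off to become Borel
    before it is continued periodically.\<close>
  define G' where "G' x = indicator {-pi..pi} x *\<^sub>R G x" for x
  have [measurable]: "G' \<in> borel_measurable borel"
    unfolding G'_def[abs_def] by (rule borel_measurable_continuous_on_indicator[OF _ G]) auto
  let ?h = "per_ext G'"
  have m[measurable]: "?h \<in> borel_measurable borel"
    unfolding per_ext_def[abs_def] by measurable
  show ae: "AE x in lborel. x \<in> {-pi..pi} \<longrightarrow> ?h x = G x"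
    by (rule AE_Icc_if_Ico) (simp add: per_ext_eq G'_def)
  have "integrable lborel (\<lambda>x. indicator {-pi..pi} x *\<^sub>R (G x)\<^sup>2)"
    using set_integrable_continuous_Icc[OF continuous_on_power[OF G, of 2]]
    by (simp add: set_integrable_def)
  hence "integrable lborel (\<lambda>x. indicator {-pi..pi} x *\<^sub>R (?h x)\<^sup>2)"
  proof (rule integrable_cong_AE_imp)
    show "AE x in lborel. indicator {-pi..pi} x *\<^sub>R (G x)\<^sup>2 = indicator {-pi..pi} x *\<^sub>R (?h x)\<^sup>2"
      using ae by eventually_elim (auto simp: indicator_def)
  qed measurable
  thus "?h \<in> sq_integrable_per"
    using m per_ext_periodic by (simp add: sq_integrable_per_def set_integrable_def)
qed

text \<open>The zero mean of g makes its indefinite integral periodic; the additive constant m is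
  then chosen to give this integral mean zero.\<close>

lemma weak_antideriv_exists:
  assumes "g \<in> L2per_zero_mean"
  shows "\<exists>F. F \<in> L2per_zero_mean \<and> has_weak_deriv F g"
proof -
  obtain g' where g': "g' \<in> sq_integrable_per" "g = abs_L2per g'" by (rule L2per_cases)
  note gi = sq_integrable_per_set_integrable[OF g'(1)]
  define U0 where "U0 x = (LINT y:{-pi..x}|lborel. g' y)" for x
  have U0: "ac_on (-pi) pi U0 g'"
    using ac_on_indefinite_integral[OF gi, of 0] by (simp add: U0_def[abs_def])
  note U0i = set_integrable_continuous_Icc[OF ac_on_continuous[OF U0]]
  define m where "m = - (LINT x:{-pi..pi}|lborel. U0 x) / (2 * pi)"
  define U where "U x = m + U0 x" for x
  have U: "ac_on (-pi) pi U g'"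
    unfolding U_def[abs_def] U0_def[abs_def] by (rule ac_on_indefinite_integral[OF gi])
  have per: "U pi = U (-pi)"
    using ac_on_integral[OF U] assms by (simp add: g'(2) L2per_zero_mean_abs_L2per g'(1))
  obtain h where h: "h \<in> sq_integrable_per" "AE x in lborel. x \<in> {-pi..pi} \<longrightarrow> h x = U x"
    using sq_integrable_per_continuous[OF ac_on_continuous[OF U]] by blast
  have "(LINT x:{-pi..pi}|lborel. h x) = (LINT x:{-pi..pi}|lborel. U x)"
    by (intro set_integral_cong_AE_Icc h(2) sq_integrable_per_set_integrable[OF h(1)]
        set_integrable_continuous_Icc ac_on_continuous[OF U])
  also have "\<dots> = (LINT x:{-pi..pi}|lborel. m) + (LINT x:{-pi..pi}|lborel. U0 x)"
    unfolding U_def by (intro set_integral_add U0i set_integrable_continuous_Icc continuous_intros)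
  also have "(LINT x:{-pi..pi}|lborel. m) = 2 * pi * m"
    by (simp add: set_lebesgue_integral_def)
  also have "2 * pi * m + (LINT x:{-pi..pi}|lborel. U0 x) = 0"
    by (simp add: m_def)
  finally have "abs_L2per h \<in> L2per_zero_mean"
    by (simp add: L2per_zero_mean_abs_L2per h(1))
  thus ?thesis
    using has_weak_deriv_of_ac_on[OF h(1) g'(1) U per h(2)] g'(2) by blast
qed

lemma has_weak_deriv_dz_inv:
  assumes "g \<in> L2per_zero_mean"
  shows "has_weak_deriv (dz_inv g) g"
proof -
  have "\<exists>!F. F \<in> L2per_zero_mean \<and> has_weak_deriv F g"
    using weak_antideriv_exists[OF assms] weak_antideriv_unique by blast
  from theI'[OF this] show ?thesis by (simp add: dz_inv_def)
qed

text \<open>The product F g is half the derivative of F^2, whose boundary values agree by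
  periodicity. Applied to \<open>dz_inv\<close>, this removes the nonlocal term from the energy
  balance.\<close>

lemma inner_weak_deriv_self:
  assumes "has_weak_deriv F g"
  shows "inner F g = 0"
proof -
  obtain F' where F': "F' \<in> sq_integrable_per" "F = abs_L2per F'" by (rule L2per_cases)
  obtain g' where g': "g' \<in> sq_integrable_per" "g = abs_L2per g'" by (rule L2per_cases)
  obtain U where U: "ac_on (-pi) pi U g'" "U pi = U (-pi)"
    "AE x in lborel. x \<in> {-pi..pi} \<longrightarrow> F' x = U x"
    using has_weak_deriv_imp_ac_on[OF F'(1) g'(1)] assms F'(2) g'(2) by metis
  have UU: "ac_on (-pi) pi (\<lambda>x. U x * U x) (\<lambda>x. g' x * U x + U x * g' x)"
    by (rule ac_on_mult[OF U(1) U(1)])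
  have "(LINT x:{-pi..pi}|lborel. 2 * (F' x * g' x)) = (LINT x:{-pi..pi}|lborel. g' x * U x + U x * g' x)"
  proof (rule set_integral_cong_AE_Icc)
    show "AE x in lborel. x \<in> {-pi..pi} \<longrightarrow> 2 * (F' x * g' x) = g' x * U x + U x * g' x"
      using U(3) by eventually_elim auto
    show "set_integrable lborel {-pi..pi} (\<lambda>x. g' x * U x + U x * g' x)"
      using UU by (simp add: ac_on_def)
    show "set_integrable lborel {-pi..pi} (\<lambda>x. 2 * (F' x * g' x))"
      by (intro set_integrable_mult_right sq_integrable_per_integrable_mult F' g')
  qed
  also have "\<dots> = 0"
    by (subst ac_on_integral[OF UU]) (simp_all add: U(2))
  finally show ?thesis
    by (simp add: F'(2) g'(2) inner_abs_L2per[OF F'(1) g'(1)])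
qed

section \<open>The energy estimate\<close>

text \<open>Formally, $\int v\,(w v)' = \frac12 \int w' v^2$ with $w' = -2z$. Testing with
  $w v / (w + \varepsilon)$ instead of $v$ makes the boundary terms cancel by periodicity.\<close>

lemma integral_weighted_weak_deriv:
  assumes f: "f \<in> sq_integrable_per" and g: "g \<in> sq_integrable_per"
    and wd: "has_weak_deriv (weight_mult (abs_L2per f)) (abs_L2per g)"
  shows "(LINT x:{-pi..pi}|lborel. f x * g x + x * (f x)\<^sup>2) = 0"
proof -
  have wf: "(\<lambda>x. weight x * f x) \<in> sq_integrable_per"
    by (rule sq_integrable_per_mult_bounded[OF f weight_measurable weight_periodic weight_bounded])
  have "weight_mult (abs_L2per f) = abs_L2per (\<lambda>x. weight x * f x)"
    using f by (simp add: weight_mult.abs_eq L2per_rel_refl_iff)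
  then obtain U where U: "ac_on (-pi) pi U g" and per: "U pi = U (-pi)"
    and ae: "AE x in lborel. x \<in> {-pi..pi} \<longrightarrow> weight x * f x = U x"
    using has_weak_deriv_imp_ac_on[OF wf g] wd by metis
  define w :: "real \<Rightarrow> real" where "w x = pi\<^sup>2 - x\<^sup>2" for x
  have "AE x in lborel. x \<in> {-pi..pi} \<longrightarrow> weight x = w x"
    by (rule AE_Icc_if_Ico) (simp add: weight_def per_ext_eq w_def)
  with ae have Uw: "AE x in lborel. x \<in> {-pi..pi} \<longrightarrow> U x = w x * f x"
    by eventually_elim auto
  have w0: "w x \<ge> 0" if "x \<in> {-pi..pi}" for x
    using that power_mono[of "\<bar>x\<bar>" pi 2] by (simp add: w_def abs_le_iff)
  have w1: "w x > 0" if "x \<in> {-pi<..<pi}" for x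
    using that power_strict_mono[of "\<bar>x\<bar>" pi 2] by (simp add: w_def abs_less_iff)
  have [measurable]: "f \<in> borel_measurable borel" "g \<in> borel_measurable borel" "w \<in> borel_measurable borel"
    using f g by (auto simp: sq_integrable_per_def w_def[abs_def])
  \<comment> \<open>This is half the derivative of U^2 / (w + e), rewritten with U = w f and w' =
    -2x. As e tends to 0 it converges to f g + x f^2 wherever w > 0.\<close>
  define k :: "real \<Rightarrow> real \<Rightarrow> real" where
    "k e x = f x * g x * (w x / (w x + e)) + x * (f x)\<^sup>2 * (w x / (w x + e))\<^sup>2" for e x
  have [measurable]: "k e \<in> borel_measurable borel" for e
    unfolding k_def[abs_def] by measurable
  \<comment> \<open>A majorant independent of e, since w / (w + e) lies in [0, 1] and |x| <=
    pi.\<close>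
  define B where "B x = \<bar>f x * g x\<bar> + pi * (f x)\<^sup>2" for x
  have Bi: "integrable lborel (\<lambda>x. indicator {-pi..pi} x *\<^sub>R B x)"
  proof -
    have "set_integrable lborel {-pi..pi} (\<lambda>x. \<bar>f x * g x\<bar> + pi * (f x)\<^sup>2)"
      using f sq_integrable_per_integrable_mult[OF f g]
      by (intro set_integral_add(1) set_integrable_abs set_integrable_mult_right)
        (auto simp: sq_integrable_per_def)
    thus ?thesis by (simp add: set_integrable_def B_def)
  qed
  have kB: "\<bar>k e x\<bar> \<le> B x" if "e > 0" "x \<in> {-pi..pi}" for e x
  proof -
    define r where "r = w x / (w x + e)"
    have r: "0 \<le> r" "r \<le> 1" using w0[OF that(2)] that(1) by (simp_all add: r_def)
    have "\<bar>k e x\<bar> \<le> \<bar>f x * g x * r\<bar> + \<bar>x * (f x)\<^sup>2 * r\<^sup>2\<bar>"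
      unfolding k_def r_def by (rule abs_triangle_ineq)
    also have "\<dots> = \<bar>f x * g x\<bar> * r + \<bar>x\<bar> * (f x)\<^sup>2 * r\<^sup>2"
      using r by (simp add: abs_mult)
    also have "\<dots> \<le> \<bar>f x * g x\<bar> * 1 + pi * (f x)\<^sup>2 * 1"
      using r that(2) by (intro add_mono mult_mono power_le_one) auto
    finally show ?thesis by (simp add: B_def)
  qed
  have ki: "set_integrable lborel {-pi..pi} (k e)" if "e > 0" for e
    unfolding set_integrable_def
    by (rule Bochner_Integration.integrable_bound[OF Bi])
      (use kB[OF that] in \<open>auto simp: indicator_def intro!: AE_I2 order_trans[OF _ abs_ge_self]\<close>)
  have k0: "(LINT x:{-pi..pi}|lborel. k e x) = 0" if e: "e > 0" for e
  proof -
    have ne: "w x + e \<noteq> 0" if "x \<in> {-pi..pi}" for x using w0[OF that] e by simp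
    \<comment> \<open>With e > 0 the denominator stays positive up to the endpoints, where w
      vanishes; 1 / w itself would be singular there.\<close>
    have V: "ac_on (-pi) pi (\<lambda>x. 1 / (w x + e)) (\<lambda>x. 2 * x / (w x + e)\<^sup>2)"
    proof (rule ac_on_C1)
      fix x assume "x \<in> {-pi..pi}"
      thus "((\<lambda>x. 1 / (w x + e)) has_real_derivative 2 * x / (w x + e)\<^sup>2) (at x within {-pi..pi})"
        using ne unfolding w_def
        by (auto intro!: derivative_eq_intros simp: power2_eq_square)
    next
      show "continuous_on {-pi..pi} (\<lambda>x. 2 * x / (w x + e)\<^sup>2)"
        using ne unfolding w_def by (auto intro!: continuous_intros)
    qed
    let ?K = "\<lambda>x. (g x * U x + U x * g x) * (1 / (w x + e)) + U x * U x * (2 * x / (w x + e)\<^sup>2)"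
    have A: "ac_on (-pi) pi (\<lambda>x. U x * U x * (1 / (w x + e))) ?K"
      by (rule ac_on_mult[OF ac_on_mult[OF U U] V])
    have "(LINT x:{-pi..pi}|lborel. 2 * k e x) = (LINT x:{-pi..pi}|lborel. ?K x)"
    proof (rule set_integral_cong_AE_Icc)
      show "AE x in lborel. x \<in> {-pi..pi} \<longrightarrow> 2 * k e x = ?K x"
        using Uw by eventually_elim (auto simp: k_def power2_eq_square algebra_simps)
    qed (use A ki[OF e] in \<open>auto simp: ac_on_def\<close>)
    also have "\<dots> = 0"
      \<comment> \<open>The boundary terms cancel: U takes equal values at both ends, and w + e
        equals e at both.\<close>
      by (subst ac_on_integral[OF A]) (simp_all add: per w_def)
    finally show ?thesis by simp
  qed
  have "(\<lambda>n. LINT x|lborel. indicator {-pi..pi} x *\<^sub>R k (1 / real (Suc n)) x) \<longlonglongrightarrow>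
      (LINT x|lborel. indicator {-pi..pi} x *\<^sub>R (f x * g x + x * (f x)\<^sup>2))"
  proof (rule integral_dominated_convergence[OF _ _ Bi])
    show "AE x in lborel. (\<lambda>n. indicator {-pi..pi} x *\<^sub>R k (1 / real (Suc n)) x) \<longlonglongrightarrow>
        indicator {-pi..pi} x *\<^sub>R (f x * g x + x * (f x)\<^sup>2)"
      \<comment> \<open>The endpoints are excluded because w / (w + e) is 0 there for every e,
        instead of tending to 1.\<close>
      using AE_lborel_singleton[of pi] AE_lborel_singleton[of "-pi"]
    proof eventually_elim
      case (elim x)
      show ?case
      proof (cases "x \<in> {-pi..pi}")
        case True
        hence "w x > 0" using elim by (intro w1) auto
        hence "(\<lambda>n. k (1 / real (Suc n)) x) \<longlonglongrightarrow>
            f x * g x * (w x / (w x + 0)) + x * (f x)\<^sup>2 * (w x / (w x + 0))\<^sup>2"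
          unfolding k_def by (intro tendsto_intros LIMSEQ_Suc[OF lim_1_over_n]) auto
        thus ?thesis using True \<open>w x > 0\<close> by simp
      qed simp
    qed
    show "AE x in lborel. norm (indicator {-pi..pi} x *\<^sub>R k (1 / real (Suc n)) x) \<le>
        indicator {-pi..pi} x *\<^sub>R B x" for n
      using kB[of "1 / real (Suc n)"] by (auto simp: indicator_def)
  qed measurable
  thus ?thesis
    using k0 LIMSEQ_unique[OF tendsto_const[of 0]] unfolding set_lebesgue_integral_def by simp
qed

text \<open>The inner product equals minus the integral of x v^2, and pi is the largest value of -x
  on the period. The rate of growth in the theorem originates here.\<close>

lemma inner_weighted_weak_deriv_le:
  assumes "has_weak_deriv (weight_mult v) g"
  shows "inner v g \<le> pi * (norm v)\<^sup>2"
proof -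
  obtain f where f: "f \<in> sq_integrable_per" "v = abs_L2per f" by (rule L2per_cases)
  obtain h where h: "h \<in> sq_integrable_per" "g = abs_L2per h" by (rule L2per_cases)
  have ff: "set_integrable lborel {-pi..pi} (\<lambda>x. (f x)\<^sup>2)"
    using f by (simp add: sq_integrable_per_def)
  have fh: "set_integrable lborel {-pi..pi} (\<lambda>x. f x * h x)"
    by (intro sq_integrable_per_integrable_mult f h)
  have xf: "set_integrable lborel {-pi..pi} (\<lambda>x. x * (f x)\<^sup>2)"
    using set_integrable_mult_continuous[OF ff continuous_on_id] by (simp add: mult.commute)
  have "inner v g = (LINT x:{-pi..pi}|lborel. f x * h x)"
    by (simp add: f(2) h(2) inner_abs_L2per f h)
  also have "\<dots> = - (LINT x:{-pi..pi}|lborel. x * (f x)\<^sup>2)"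
    using integral_weighted_weak_deriv[OF f(1) h(1)] assms
    by (simp add: f(2) h(2) set_integral_add(2)[OF fh xf])
  also have "\<dots> = (LINT x:{-pi..pi}|lborel. - (x * (f x)\<^sup>2))"
    by (simp add: set_integral_uminus xf)
  also have "\<dots> \<le> (LINT x:{-pi..pi}|lborel. pi * (f x)\<^sup>2)"
  proof (rule set_integral_mono)
    show "set_integrable lborel {-pi..pi} (\<lambda>x. - (x * (f x)\<^sup>2))"
      using set_integrable_mult_right[OF xf, of "-1"] by simp
    show "set_integrable lborel {-pi..pi} (\<lambda>x. pi * (f x)\<^sup>2)"
      using ff by simp
    show "- (x * (f x)\<^sup>2) \<le> pi * (f x)\<^sup>2" if "x \<in> {-pi..pi}" for x
      using mult_right_mono[of "-x" pi "(f x)\<^sup>2"] that by simp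
  qed
  also have "\<dots> = pi * (norm v)\<^sup>2"
    by (simp add: power2_norm_eq_inner) (simp add: f(2) inner_abs_L2per f(1) power2_eq_square)
  finally show ?thesis .
qed

theorem lemma5:
  fixes v0 :: L2per and v :: "real \<Rightarrow> L2per"
  assumes "v0 \<in> X1per" and "global_solution v0 v"
  shows "\<forall>t>0. norm (v t) \<le> norm v0 * exp (pi * t / 6)"
proof (intro allI impI)
  fix t :: real assume t: "t > 0"
  have X: "v s \<in> X1per" and lim: "((\<lambda>r. X1norm (v r - v s)) \<longlongrightarrow> 0) (at s)"
    and v0: "v 0 = v0" for s
    using assms(2) by (auto simp: global_solution_def continuous_X1_def)
  \<comment> \<open>The \<open>X1norm\<close> dominates the norm of \<open>L2per\<close>, so v is
    continuous in \<open>L2per\<close> also at time 0, where the equation, posed for positive times,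
    supplies no derivative.\<close>
  have cont: "isCont v s" for s
  proof -
    have "((\<lambda>r. v r - v s) \<longlongrightarrow> 0) (at s)"
      by (rule Lim_null_comparison[OF _ lim]) (simp add: X1norm_def)
    thus ?thesis using LIM_zero_iff by (auto simp: isCont_def)
  qed
  \<comment> \<open>The rate pi / 3 is 2 * (1/6) * pi: the 2 comes from differentiating a square,
    the 1/6 from the equation, and pi from \<open>inner_weighted_weak_deriv_le\<close>.\<close>
  let ?E = "\<lambda>s. inner (v s) (v s) * exp (- (pi / 3) * s)"
  have "?E t \<le> ?E 0"
  proof (rule DERIV_nonpos_imp_decreasing_open[of 0 t])
    show "continuous_on {0..t} ?E"
      by (intro continuous_intros continuous_at_imp_continuous_on ballI cont)
  next
    fix s :: real assume s: "0 < s" "s < t"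
    obtain vt where vt: "(v has_vector_derivative vt) (at s)"
      and eq: "vt + (1/6) *\<^sub>R dz (- weight_mult (v s)) = dz_inv (v s)"
      using assms(2) s by (auto simp: global_solution_def)
    have zm: "v s \<in> L2per_zero_mean" using X[of s] by (simp add: X1per_def)
    obtain h where "has_weak_deriv ((1/6) *\<^sub>R weight_mult (v s)) h"
      using X[of s] by (auto simp: X1per_def H1per_def)
    \<comment> \<open>\<open>X1per\<close> speaks of w v / 6, the estimate of w v, and the equation
      of - w v; the factors 6 and -6 pass between them.\<close>
    from has_weak_deriv_scaleR[OF this, of 6] has_weak_deriv_scaleR[OF this, of "-6"]
    have w: "has_weak_deriv (weight_mult (v s)) (6 *\<^sub>R h)"
      and "has_weak_deriv (- weight_mult (v s)) ((-6) *\<^sub>R h)"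
      by simp_all
    from eq dz_eqI[OF this(2)] have "vt = dz_inv (v s) + h"
      by (simp add: diff_eq_eq)
    hence "2 * inner (v s) vt = 2 * inner (dz_inv (v s)) (v s) + inner (v s) (6 *\<^sub>R h) / 3"
      by (simp add: inner_add_right inner_commute)
    also have "\<dots> \<le> pi / 3 * inner (v s) (v s)"
      using inner_weighted_weak_deriv_le[OF w]
      by (simp add: inner_weak_deriv_self[OF has_weak_deriv_dz_inv[OF zm]] power2_norm_eq_inner)
    finally have le: "2 * inner (v s) vt - pi / 3 * inner (v s) (v s) \<le> 0" by simp
    have "((\<lambda>s. inner (v s) (v s)) has_derivative (\<lambda>d. inner (v s) (d *\<^sub>R vt) + inner (d *\<^sub>R vt) (v s))) (at s)"
      using vt unfolding has_vector_derivative_def by (intro has_derivative_inner)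
    hence "((\<lambda>s. inner (v s) (v s)) has_real_derivative 2 * inner (v s) vt) (at s)"
      unfolding has_field_derivative_def
      by (rule has_derivative_eq_rhs) (auto simp: inner_commute)
    hence "(?E has_real_derivative (2 * inner (v s) vt - pi / 3 * inner (v s) (v s)) *
        exp (- (pi / 3) * s)) (at s)"
      by (auto intro!: derivative_eq_intros simp: algebra_simps)
    thus "\<exists>y. (?E has_real_derivative y) (at s) \<and> y \<le> 0"
      using le by (intro exI conjI) (auto intro: mult_nonpos_nonneg)
  qed (use t in simp)
  \<comment> \<open>Undo the integrating factor; the square root afterwards halves the rate to pi /
    6.\<close>
  hence "inner (v t) (v t) * exp (- (pi / 3) * t) * exp (pi / 3 * t) \<le> inner v0 v0 * exp (pi / 3 * t)"
    by (intro mult_right_mono) (simp_all add: v0)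
  hence "(norm (v t))\<^sup>2 \<le> (norm v0)\<^sup>2 * exp (pi / 3 * t)"
    by (simp add: power2_norm_eq_inner mult.assoc flip: exp_add)
  also have "\<dots> = (norm v0 * exp (pi * t / 6))\<^sup>2"
    by (simp add: power_mult_distrib power2_eq_square flip: exp_add)
  finally show "norm (v t) \<le> norm v0 * exp (pi * t / 6)"
    by (rule power2_le_imp_le) simp
qed

end
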